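(* (a) Being torsion-free is not a profinite property: there exist finitely generated residually finite groups $\Gamma_1$ and $\Gamma_2$ with $\hat\Gamma_1 \simeq \hat\Gamma_2$ such that one of them is torsion-free and the other is not. (b) Having trivial center is not a profinite property: there exist finitely generated residually finite groups $\Gamma_1$ and $\Gamma_2$ with $\hat\Gamma_1 \simeq \hat\Gamma_2$ such that one of them has trivial center and the other does not.
   Context: A property $P$ of groups is called a profinite property if whenever $\Gamma_1$ and $\Gamma_2$ are finitely generated residually finite groups with $\hat\Gamma_1 \simeq \hat\Gamma_2$ and $\Gamma_1$ has $P$, so does $\Gamma_2$. Here $\hat\Gamma$ denotes the profinite completion of $\Gamma$ (the inverse limit of its finite quotients), and $\simeq$ is isomorphism of topological groups. *)

theory Defs
  imports
    "HOL-Algebra.Generated_Groups"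
    "HOL-Algebra.Product_Groups"
    "HOL-Analysis.Function_Topology"
begin


definition finitely_generated :: "('a, 'b) monoid_scheme \<Rightarrow> bool" where
  "finitely_generated G \<longleftrightarrow> (\<exists>S. finite S \<and> S \<subseteq> carrier G \<and> generate G S = carrier G)"

definition finite_index_normals :: "('a, 'b) monoid_scheme \<Rightarrow> 'a set set" where
  "finite_index_normals G = {N. N \<lhd> G \<and> finite (carrier (G Mod N))}"

definition residually_finite :: "('a, 'b) monoid_scheme \<Rightarrow> bool" where
  "residually_finite G \<longleftrightarrow>
     (\<forall>g\<in>carrier G. g \<noteq> \<one>\<^bsub>G\<^esub> \<longrightarrow> (\<exists>N\<in>finite_index_normals G. g \<notin> N))"

text \<open>
  The profinite completion is the inverse limit of the finite quotients \<open>G Mod N\<close>, realised as the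
  group of compatible families inside their product. For \<open>M \<subseteq> N\<close> the transition map
  \<open>G Mod M \<rightarrow> G Mod N\<close> is \<open>C \<mapsto> N <#> C\<close>; it sends the coset of \<open>x\<close> modulo \<open>M\<close> to the coset of \<open>x\<close>
  modulo \<open>N\<close>.
\<close>

definition profinite_completion ::
    "('a, 'b) monoid_scheme \<Rightarrow> ('a set \<Rightarrow> 'a set) monoid" where
  "profinite_completion G =
     (product_group (finite_index_normals G) (\<lambda>N. G Mod N))
       \<lparr>carrier := {x \<in> carrier (product_group (finite_index_normals G) (\<lambda>N. G Mod N)).
          \<forall>M\<in>finite_index_normals G. \<forall>N\<in>finite_index_normals G.
            M \<subseteq> N \<longrightarrow> N <#>\<^bsub>G\<^esub> x M = x N}\<rparr>"

definition profinite_topology ::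
    "('a, 'b) monoid_scheme \<Rightarrow> ('a set \<Rightarrow> 'a set) topology" where
  "profinite_topology G =
     subtopology
       (product_topology (\<lambda>N. discrete_topology (carrier (G Mod N))) (finite_index_normals G))
       (carrier (profinite_completion G))"

definition isomorphic_profinite_completions ::
    "('a, 'c) monoid_scheme \<Rightarrow> ('b, 'd) monoid_scheme \<Rightarrow> bool" where
  "isomorphic_profinite_completions G H \<longleftrightarrow>
     (\<exists>f. f \<in> iso (profinite_completion G) (profinite_completion H) \<and>
          homeomorphic_map (profinite_topology G) (profinite_topology H) f)"

text \<open>
  HOL cannot quantify over the carrier types, so the two groups range over one type \<open>'a\<close>. Finitely
  generated groups are countable, so for an isomorphism-invariant property nothing is lost with
  \<open>'a = nat\<close>.
\<close>

definition profinite_property :: "('a monoid \<Rightarrow> bool) \<Rightarrow> bool" where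
  "profinite_property P \<longleftrightarrow>
     (\<forall>\<Gamma>\<^sub>1 \<Gamma>\<^sub>2. group \<Gamma>\<^sub>1 \<and> finitely_generated \<Gamma>\<^sub>1 \<and> residually_finite \<Gamma>\<^sub>1 \<and>
              group \<Gamma>\<^sub>2 \<and> finitely_generated \<Gamma>\<^sub>2 \<and> residually_finite \<Gamma>\<^sub>2 \<and>
              isomorphic_profinite_completions \<Gamma>\<^sub>1 \<Gamma>\<^sub>2 \<and> P \<Gamma>\<^sub>1 \<longrightarrow> P \<Gamma>\<^sub>2)"

definition torsion_free :: "('a, 'b) monoid_scheme \<Rightarrow> bool" where
  "torsion_free G \<longleftrightarrow>
     (\<forall>x\<in>carrier G. \<forall>n::nat. n > 0 \<and> x [^]\<^bsub>G\<^esub> n = \<one>\<^bsub>G\<^esub> \<longrightarrow> x = \<one>\<^bsub>G\<^esub>)"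

definition group_center :: "('a, 'b) monoid_scheme \<Rightarrow> 'a set" where
  "group_center G = {z \<in> carrier G. \<forall>x\<in>carrier G. z \<otimes>\<^bsub>G\<^esub> x = x \<otimes>\<^bsub>G\<^esub> z}"

definition has_trivial_center :: "('a, 'b) monoid_scheme \<Rightarrow> bool" where
  "has_trivial_center G \<longleftrightarrow> group_center G = {\<one>\<^bsub>G\<^esub>}"

end

(* Let R = Z[t, 1/t]. P. Hall's solvable groups consist of tuples (n, a, b, c) with n an integer, a and b in R
   and c central, where the commutator of a and b is a linear functional of the product a b and t acts on c by
   inversion. Applying to b, separately for each prime q, a power t^j with j depending on q is invisible to the
   finite quotients, since they split into pieces for the different primes, but it changes the group of
   commutators in the centre.

   Take the functional t^k |-> g(k) for an integer sequence g which is periodic modulo each prime q, but not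
   modulo any integer that is not squarefree, and which contains modulo q arbitrarily long stretches 0...0 c 0...0
   with c nonzero as q grows. Untwisted, the commutators form the infinite cyclic group Z, seen by finite quotients
   only modulo squarefree integers; the group is torsion-free with trivial centre. Shifting to the centres of
   the stretches turns the commutators into a group which contains elements supported at the single prime 2: these
   are involutions, and they are central as t acts by inversion. Both groups are dense in the same larger group,
   with the same induced congruence topology. *)

theory Submission
  imports Defs
    "HOL-Library.Poly_Mapping"
    "HOL-Computational_Algebra.Primes"
    "HOL-Number_Theory.Cong"
    "HOL-Algebra.Multiplicative_Group"
begin

section \<open>Inverse limits of finite quotients\<close>

text \<open>The obstacle is to control all finite quotients, although the c coordinate ranges over
  an infinite group. If a normal subgroup contains all e-th powers, then it contains t^(2e) and
  hence, by commutators, the ideal (e, t^(2e) - 1) in the a and b coordinates, and then its image in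
  the c coordinate. So everything rests on recognising the image of an ideal (d, t^m - 1) by
  finitely many primes, which is \<open>centre_detected\<close>. Untwisted, this image contains g(k)
  - g(0) for every multiple k of m. The peaks k = \<open>2 * radius l\<close> are divisible by m for
  large l, and g takes there the product of the first l primes. This product is squarefree, so no
  square of a prime survives in a finite quotient. Twisted, a monomial t^k with k nonzero has
  finitely many nonzero coordinates, so r becomes finitely supported once its constant term is moved
  to some t^K. A finitely supported vector away from the primes dividing d is killed by an integer
  prime to d, hence is a multiple of d. This dictates the form of g: isolated peaks at highly
  divisible places, each invisible modulo the earlier primes.\<close>

definition inverse_limit :: "('a, 'b) monoid_scheme \<Rightarrow> 'a set set \<Rightarrow> ('a set \<Rightarrow> 'a set) monoid" where
  "inverse_limit G \<N> =
     (product_group \<N> (\<lambda>N. G Mod N))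
       \<lparr>carrier := {x \<in> carrier (product_group \<N> (\<lambda>N. G Mod N)).
          \<forall>M\<in>\<N>. \<forall>N\<in>\<N>. M \<subseteq> N \<longrightarrow> N <#>\<^bsub>G\<^esub> x M = x N}\<rparr>"

definition limit_topology :: "('a, 'b) monoid_scheme \<Rightarrow> 'a set set \<Rightarrow> ('a set \<Rightarrow> 'a set) topology" where
  "limit_topology G \<N> =
     subtopology (product_topology (\<lambda>N. discrete_topology (carrier (G Mod N))) \<N>)
       (carrier (inverse_limit G \<N>))"

lemma profinite_completion_eq_inverse_limit:
  "profinite_completion G = inverse_limit G (finite_index_normals G)"
  by (simp add: profinite_completion_def inverse_limit_def)

lemma profinite_topology_eq_limit_topology:
  "profinite_topology G = limit_topology G (finite_index_normals G)"
  by (simp add: profinite_topology_def limit_topology_def profinite_completion_eq_inverse_limit)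

lemma carrier_inverse_limit:
  "x \<in> carrier (inverse_limit G \<N>) \<longleftrightarrow>
     x \<in> (\<Pi>\<^sub>E N\<in>\<N>. rcosets\<^bsub>G\<^esub> N) \<and>
     (\<forall>M\<in>\<N>. \<forall>N\<in>\<N>. M \<subseteq> N \<longrightarrow> N <#>\<^bsub>G\<^esub> x M = x N)"
  by (auto simp: inverse_limit_def FactGroup_def)

lemma mult_inverse_limit: "x \<otimes>\<^bsub>inverse_limit G \<N>\<^esub> y = (\<lambda>N\<in>\<N>. x N <#>\<^bsub>G\<^esub> y N)"
  by (simp add: inverse_limit_def)

lemma topspace_limit_topology [simp]: "topspace (limit_topology G \<N>) = carrier (inverse_limit G \<N>)"
  unfolding limit_topology_def topspace_subtopology topspace_product_topology
  by (fastforce simp: carrier_inverse_limit FactGroup_def)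

lemma continuous_map_limit_coordinate:
  assumes "N \<in> \<N>"
  shows "continuous_map (limit_topology G \<N>) (discrete_topology (rcosets\<^bsub>G\<^esub> N)) (\<lambda>x. x N)"
  unfolding limit_topology_def
  using continuous_map_product_projection[OF assms, of "\<lambda>N. discrete_topology (carrier (G Mod N))"]
  by (simp add: continuous_map_from_subtopology FactGroup_def)

text \<open>The factors are discrete, so a coordinate of \<open>f\<close> that is a function of one
  coordinate of the argument is continuous, whatever that function is.\<close>

lemma continuous_map_into_limit:
  assumes "f \<in> carrier (inverse_limit H \<M>) \<rightarrow> carrier (inverse_limit G \<N>)"
    and "\<And>N. N \<in> \<N> \<Longrightarrow> \<exists>M\<in>\<M>. \<exists>\<phi>. \<forall>x\<in>carrier (inverse_limit H \<M>). f x N = \<phi> (x M)"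
  shows "continuous_map (limit_topology H \<M>) (limit_topology G \<N>) f"
proof -
  have f_in: "f x \<in> (\<Pi>\<^sub>E N\<in>\<N>. rcosets\<^bsub>G\<^esub> N)" if "x \<in> carrier (inverse_limit H \<M>)" for x
    using funcset_mem[OF assms(1) that] by (simp add: carrier_inverse_limit)
  have "continuous_map (limit_topology H \<M>) (discrete_topology (carrier (G Mod N))) (\<lambda>x. f x N)"
    if N: "N \<in> \<N>" for N
  proof -
    obtain M \<phi> where M: "M \<in> \<M>"
      and \<phi>: "\<And>x. x \<in> carrier (inverse_limit H \<M>) \<Longrightarrow> f x N = \<phi> (x M)"
      using assms(2)[OF N] by blast
    \<comment> \<open>\<open>\<phi>\<close> is controlled only on values that occur, so the discrete
      space is cut down to these.\<close>
    define X where "X = (\<lambda>x. x M) ` carrier (inverse_limit H \<M>)"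
    have "continuous_map (limit_topology H \<M>) (subtopology (discrete_topology (rcosets\<^bsub>H\<^esub> M)) X) (\<lambda>x. x M)"
      using continuous_map_limit_coordinate[OF M, of H]
      by (auto simp: continuous_map_in_subtopology X_def simp del: subtopology_discrete_topology)
    moreover have "X \<subseteq> rcosets\<^bsub>H\<^esub> M"
      using M by (auto simp: X_def carrier_inverse_limit)
    ultimately have "continuous_map (limit_topology H \<M>) (discrete_topology X) (\<lambda>x. x M)"
      by (simp add: Int_absorb1)
    moreover have "continuous_map (discrete_topology X) (discrete_topology (carrier (G Mod N))) \<phi>"
    proof -
      have "\<phi> (x M) \<in> rcosets\<^bsub>G\<^esub> N" if "x \<in> carrier (inverse_limit H \<M>)" for x
        using f_in[OF that] N by (simp add: \<phi>[OF that, symmetric] PiE_iff)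
      then show ?thesis
        by (auto simp: X_def FactGroup_def)
    qed
    ultimately have "continuous_map (limit_topology H \<M>) (discrete_topology (carrier (G Mod N))) (\<phi> \<circ> (\<lambda>x. x M))"
      by (rule continuous_map_compose)
    then show ?thesis
      by (rule continuous_map_eq) (simp add: \<phi>)
  qed
  then show ?thesis
    unfolding limit_topology_def[of G] continuous_map_in_subtopology continuous_map_componentwise
    using assms(1) f_in by (auto simp: PiE_iff image_subset_iff_funcset)
qed

text \<open>The families are parameters because \<open>\<M>\<close> will consist of all normal
  subgroups of finite index, while on the ambient side only a chain of levels is used.\<close>

definition limits_isomorphic ::
    "('a, 'c) monoid_scheme \<Rightarrow> 'a set set \<Rightarrow> ('b, 'd) monoid_scheme \<Rightarrow> 'b set set \<Rightarrow> bool" where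
  "limits_isomorphic H \<M> G \<N> \<longleftrightarrow>
     (\<exists>f. f \<in> iso (inverse_limit H \<M>) (inverse_limit G \<N>) \<and>
          homeomorphic_map (limit_topology H \<M>) (limit_topology G \<N>) f)"

text \<open>This describes the map induced by \<open>h\<close> on cosets without choosing
  representatives: multiplication by \<open>N\<close> fills the image of a coset up to a full
  coset.\<close>

lemma group_coset_hom_image:
  assumes G: "group G" and H: "group H" and h: "h \<in> hom H G" and N: "N \<lhd> G"
    and p: "p \<in> carrier H"
  shows "N <#>\<^bsub>G\<^esub> (h ` ((h -` N \<inter> carrier H) #>\<^bsub>H\<^esub> p)) = N #>\<^bsub>G\<^esub> h p"
proof -
  interpret G: group G by fact
  interpret H: group H by fact
  interpret h: group_hom H G h using h by unfold_locales
  interpret N: normal N G by fact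
  show ?thesis
  proof (intro equalityI subsetI)
    fix y assume "y \<in> N <#>\<^bsub>G\<^esub> (h ` ((h -` N \<inter> carrier H) #>\<^bsub>H\<^esub> p))"
    then obtain n m where "n \<in> N" "m \<in> carrier H" "h m \<in> N" "y = n \<otimes>\<^bsub>G\<^esub> h (m \<otimes>\<^bsub>H\<^esub> p)"
      by (auto simp: set_mult_def r_coset_def)
    then show "y \<in> N #>\<^bsub>G\<^esub> h p"
      using p by (auto simp: r_coset_def G.m_assoc[symmetric] intro!: bexI[of _ "n \<otimes>\<^bsub>G\<^esub> h m"])
  next
    fix y assume "y \<in> N #>\<^bsub>G\<^esub> h p"
    then obtain n where "n \<in> N" "y = n \<otimes>\<^bsub>G\<^esub> h p"
      by (auto simp: r_coset_def)
    moreover have "p \<in> (h -` N \<inter> carrier H) #>\<^bsub>H\<^esub> p"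
      using p N.one_closed by (auto simp: r_coset_def intro!: bexI[of _ "\<one>\<^bsub>H\<^esub>"])
    ultimately show "y \<in> N <#>\<^bsub>G\<^esub> (h ` ((h -` N \<inter> carrier H) #>\<^bsub>H\<^esub> p))"
      unfolding set_mult_def by blast
  qed
qed

lemma normal_vimage:
  assumes "group G" "group H" "h \<in> hom H G" "N \<lhd> G"
  shows "h -` N \<inter> carrier H \<lhd> H"
proof -
  interpret G: group G by fact
  interpret H: group H by fact
  interpret h: group_hom H G h using assms by unfold_locales
  interpret N: normal N G by fact
  have "subgroup (h -` N \<inter> carrier H) H"
    by unfold_locales auto
  then show ?thesis
    using N.inv_op_closed2 by (auto simp: H.normal_inv_iff)
qed

lemma set_mult_normal_rcos:
  assumes "group G" "M \<lhd> G" "N \<lhd> G" "M \<subseteq> N" "p \<in> carrier G"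
  shows "N <#>\<^bsub>G\<^esub> (M #>\<^bsub>G\<^esub> p) = N #>\<^bsub>G\<^esub> p"
proof -
  interpret G: group G by fact
  interpret M: normal M G by fact
  interpret N: normal N G by fact
  have "N <#>\<^bsub>G\<^esub> M = N"
    using assms(4) M.one_closed by (force simp: set_mult_def)
  then show ?thesis
    using assms(5) G.setmult_rcos_assoc[OF N.subset M.subset] by simp
qed

lemma inverse_limit_mult_closed:
  assumes "group G" "\<And>N. N \<in> \<N> \<Longrightarrow> N \<lhd> G"
    and x: "x \<in> carrier (inverse_limit G \<N>)" and y: "y \<in> carrier (inverse_limit G \<N>)"
  shows "x \<otimes>\<^bsub>inverse_limit G \<N>\<^esub> y \<in> carrier (inverse_limit G \<N>)"
proof -
  interpret G: group G by fact
  have closed: "x N <#>\<^bsub>G\<^esub> y N \<in> rcosets\<^bsub>G\<^esub> N" if "N \<in> \<N>" for N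
  proof -
    interpret normal N G using assms(2)[OF that] .
    show ?thesis
      using x y that setmult_closed by (auto simp: carrier_inverse_limit PiE_iff)
  qed
  have "N <#>\<^bsub>G\<^esub> (x M <#>\<^bsub>G\<^esub> y M) = x N <#>\<^bsub>G\<^esub> y N" if MN: "M \<in> \<N>" "N \<in> \<N>" "M \<subseteq> N" for M N
  proof -
    interpret M: normal M G using assms(2)[OF MN(1)] .
    interpret N: normal N G using assms(2)[OF MN(2)] .
    obtain p r where p: "p \<in> carrier G" "x M = M #>\<^bsub>G\<^esub> p" and r: "r \<in> carrier G" "y M = M #>\<^bsub>G\<^esub> r"
      using x y MN(1) unfolding carrier_inverse_limit PiE_iff RCOSETS_def by fast
    have N: "N <#>\<^bsub>G\<^esub> (M #>\<^bsub>G\<^esub> s) = N #>\<^bsub>G\<^esub> s" if "s \<in> carrier G" for s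
      using set_mult_normal_rcos[OF \<open>group G\<close>] assms(2) MN that by blast
    have "x N = N #>\<^bsub>G\<^esub> p" "y N = N #>\<^bsub>G\<^esub> r"
      using x y MN p r N unfolding carrier_inverse_limit by metis+
    then show ?thesis
      using p r N by (simp add: M.rcos_sum N.rcos_sum)
  qed
  with closed show ?thesis
    by (auto simp: carrier_inverse_limit mult_inverse_limit)
qed

lemma rcos_eq_iff:
  assumes "group G" "subgroup N G" "p \<in> carrier G" "p' \<in> carrier G"
  shows "N #>\<^bsub>G\<^esub> p = N #>\<^bsub>G\<^esub> p' \<longleftrightarrow> p' \<otimes>\<^bsub>G\<^esub> inv\<^bsub>G\<^esub> p \<in> N"
proof -
  interpret G: group G by fact
  have "p' \<in> N #>\<^bsub>G\<^esub> p \<longleftrightarrow> p' \<otimes>\<^bsub>G\<^esub> inv\<^bsub>G\<^esub> p \<in> N"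
    using subgroup.rcos_module[OF assms(2,1,3,4)] .
  moreover have "N #>\<^bsub>G\<^esub> p = N #>\<^bsub>G\<^esub> p' \<longleftrightarrow> p' \<in> N #>\<^bsub>G\<^esub> p"
    using G.repr_independence[OF _ assms(3,2)] G.rcos_self[OF assms(4,2)] by blast
  ultimately show ?thesis by blast
qed

text \<open>Density makes \<open>h\<close> identify the quotient of \<open>H\<close> by the preimage
  of \<open>N\<close> with the quotient of \<open>G\<close> by \<open>N\<close>. Cofinality says
  that these quotients determine all coordinates of the limit over \<open>\<M>\<close>.\<close>

lemma limits_isomorphic_dense_hom:
  fixes H :: "('a, 'c) monoid_scheme" and G :: "('b, 'd) monoid_scheme"
  assumes H: "group H" and G: "group G" and h: "h \<in> hom H G"
    and normalH: "\<And>M. M \<in> \<M> \<Longrightarrow> M \<lhd> H" and normalG: "\<And>N. N \<in> \<N> \<Longrightarrow> N \<lhd> G"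
    and preimage: "\<And>N. N \<in> \<N> \<Longrightarrow> h -` N \<inter> carrier H \<in> \<M>"
    and dense: "\<And>N g. N \<in> \<N> \<Longrightarrow> g \<in> carrier G \<Longrightarrow> \<exists>p\<in>carrier H. g \<in> N #>\<^bsub>G\<^esub> h p"
    and cofinal: "\<And>M. M \<in> \<M> \<Longrightarrow> \<exists>N\<in>\<N>. h -` N \<inter> carrier H \<subseteq> M"
    and directed: "\<And>N N'. N \<in> \<N> \<Longrightarrow> N' \<in> \<N> \<Longrightarrow> \<exists>N''\<in>\<N>. N'' \<subseteq> N \<inter> N'"
  shows "limits_isomorphic H \<M> G \<N>"
proof -
  interpret G: group G by fact
  interpret H: group H by fact
  interpret h: group_hom H G h using h by unfold_locales
  define P where "P N = h -` N \<inter> carrier H" for N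
  have P_M: "P N \<in> \<M>" if "N \<in> \<N>" for N
    using preimage[OF that] by (simp add: P_def)
  have P_normal: "P N \<lhd> H" if "N \<in> \<N>" for N
    using normalH[OF P_M[OF that]] .
  have P_mono: "P N \<subseteq> P N'" if "N \<subseteq> N'" for N N'
    using that by (auto simp: P_def)
  define f where "f x = (\<lambda>N\<in>\<N>. N <#>\<^bsub>G\<^esub> h ` x (P N))" for x
  have push: "N <#>\<^bsub>G\<^esub> h ` (P N #>\<^bsub>H\<^esub> p) = N #>\<^bsub>G\<^esub> h p" if "N \<in> \<N>" "p \<in> carrier H" for N p
    unfolding P_def using group_coset_hom_image[OF G H h normalG] that by blast
  have eq_coset_iff: "N #>\<^bsub>G\<^esub> h p = N #>\<^bsub>G\<^esub> h p' \<longleftrightarrow> P N #>\<^bsub>H\<^esub> p = P N #>\<^bsub>H\<^esub> p'"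
    if N: "N \<in> \<N>" and p: "p \<in> carrier H" "p' \<in> carrier H" for N p p'
  proof -
    interpret N: normal N G using normalG[OF N] .
    interpret PN: normal "P N" H using P_normal[OF N] .
    have "N #>\<^bsub>G\<^esub> h p = N #>\<^bsub>G\<^esub> h p' \<longleftrightarrow> h p' \<otimes>\<^bsub>G\<^esub> inv\<^bsub>G\<^esub> h p \<in> N"
      using p by (intro rcos_eq_iff[OF G N.subgroup_axioms]) auto
    moreover have "P N #>\<^bsub>H\<^esub> p = P N #>\<^bsub>H\<^esub> p' \<longleftrightarrow> p' \<otimes>\<^bsub>H\<^esub> inv\<^bsub>H\<^esub> p \<in> P N"
      using p by (intro rcos_eq_iff[OF H PN.subgroup_axioms])
    moreover have "h p' \<otimes>\<^bsub>G\<^esub> inv\<^bsub>G\<^esub> h p = h (p' \<otimes>\<^bsub>H\<^esub> inv\<^bsub>H\<^esub> p)"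
      using p by (simp only: h.hom_mult h.hom_inv H.inv_closed)
    moreover have "p' \<otimes>\<^bsub>H\<^esub> inv\<^bsub>H\<^esub> p \<in> carrier H"
      using p by simp
    ultimately show ?thesis
      by (simp only: P_def vimage_eq Int_iff simp_thms)
  qed
  have represent: "\<exists>p\<in>carrier H. y = N #>\<^bsub>G\<^esub> h p" if N: "N \<in> \<N>" and y: "y \<in> rcosets\<^bsub>G\<^esub> N" for N y
  proof -
    interpret N: normal N G using normalG[OF N] .
    obtain g where g: "g \<in> carrier G" "y = N #>\<^bsub>G\<^esub> g"
      using y by (auto simp: RCOSETS_def)
    then show ?thesis
      using dense[OF N g(1)] G.repr_independence[OF _ h.hom_closed N.subgroup_axioms] by blast
  qed
  have coset_up: "N <#>\<^bsub>G\<^esub> (N' #>\<^bsub>G\<^esub> g) = N #>\<^bsub>G\<^esub> g" if "N \<in> \<N>" "N' \<in> \<N>" "N' \<subseteq> N" "g \<in> carrier G" for N N' g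
    using set_mult_normal_rcos[OF G] normalG that by blast
  have coset_upH: "M <#>\<^bsub>H\<^esub> (M' #>\<^bsub>H\<^esub> p) = M #>\<^bsub>H\<^esub> p" if "M \<in> \<M>" "M' \<in> \<M>" "M' \<subseteq> M" "p \<in> carrier H" for M M' p
    using set_mult_normal_rcos[OF H] normalH that by blast
  have f_rep: "f x N = N #>\<^bsub>G\<^esub> h p" if "N \<in> \<N>" "x (P N) = P N #>\<^bsub>H\<^esub> p" "p \<in> carrier H" for x N p
    using that by (simp add: f_def push)
  have rep_x: "\<exists>p\<in>carrier H. x M = M #>\<^bsub>H\<^esub> p" if "x \<in> carrier (inverse_limit H \<M>)" "M \<in> \<M>" for x M
    using that by (auto simp: carrier_inverse_limit PiE_iff RCOSETS_def)
  have x_up: "x M' = M' #>\<^bsub>H\<^esub> p"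
    if "x \<in> carrier (inverse_limit H \<M>)" "M \<in> \<M>" "M' \<in> \<M>" "M \<subseteq> M'" "x M = M #>\<^bsub>H\<^esub> p" "p \<in> carrier H"
    for x M M' p
    using that coset_upH[of M' M p] by (auto simp: carrier_inverse_limit)
  have y_up: "y N' = N' #>\<^bsub>G\<^esub> g"
    if "y \<in> carrier (inverse_limit G \<N>)" "N \<in> \<N>" "N' \<in> \<N>" "N \<subseteq> N'" "y N = N #>\<^bsub>G\<^esub> g" "g \<in> carrier G"
    for y N N' g
    using that coset_up[of N' N g] by (auto simp: carrier_inverse_limit)
  have f_closed: "f x \<in> carrier (inverse_limit G \<N>)" if x: "x \<in> carrier (inverse_limit H \<M>)" for x
  proof -
    have "f x N \<in> rcosets\<^bsub>G\<^esub> N" if N: "N \<in> \<N>" for N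
      using rep_x[OF x P_M[OF N]] f_rep[OF N] by (auto simp: RCOSETS_def)
    moreover have "N' <#>\<^bsub>G\<^esub> f x N = f x N'" if N: "N \<in> \<N>" "N' \<in> \<N>" "N \<subseteq> N'" for N N'
    proof -
      obtain p where p: "p \<in> carrier H" "x (P N) = P N #>\<^bsub>H\<^esub> p"
        using rep_x[OF x P_M[OF N(1)]] by blast
      have "x (P N') = P N' #>\<^bsub>H\<^esub> p"
        using x_up[OF x P_M[OF N(1)] P_M[OF N(2)] P_mono[OF N(3)]] p by blast
      then show ?thesis
        using p N f_rep coset_up by simp
    qed
    moreover have "f x \<in> extensional \<N>"
      by (simp add: f_def)
    ultimately show ?thesis
      by (auto simp: carrier_inverse_limit PiE_iff)
  qed
  \<comment> \<open>The inverse map reads its coordinate at \<open>M\<close> off a single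
    \<open>N\<close> with preimage inside \<open>M\<close>. Fixing this choice makes the inverse
    visibly continuous.\<close>
  define c where "c M = (SOME N. N \<in> \<N> \<and> P N \<subseteq> M)" for M
  have c: "c M \<in> \<N>" "P (c M) \<subseteq> M" if "M \<in> \<M>" for M
    using someI_ex[of "\<lambda>N. N \<in> \<N> \<and> P N \<subseteq> M"] cofinal[OF that] by (auto simp: c_def P_def)
  define k where "k y = (\<lambda>M\<in>\<M>. M <#>\<^bsub>H\<^esub> (h -` y (c M) \<inter> carrier H))" for y
  have pull: "h -` (N #>\<^bsub>G\<^esub> h p) \<inter> carrier H = P N #>\<^bsub>H\<^esub> p" if N: "N \<in> \<N>" and p: "p \<in> carrier H" for N p
  proof (intro equalityI subsetI)
    interpret N: normal N G using normalG[OF N] .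
    interpret PN: normal "P N" H using P_normal[OF N] .
    fix r assume "r \<in> h -` (N #>\<^bsub>G\<^esub> h p) \<inter> carrier H"
    then have r: "r \<in> carrier H" "h r \<in> N #>\<^bsub>G\<^esub> h p" by auto
    then have "N #>\<^bsub>G\<^esub> h p = N #>\<^bsub>G\<^esub> h r"
      using p by (intro G.repr_independence[OF _ _ N.subgroup_axioms]) auto
    then have "P N #>\<^bsub>H\<^esub> p = P N #>\<^bsub>H\<^esub> r"
      using eq_coset_iff[OF N p r(1)] by blast
    then show "r \<in> P N #>\<^bsub>H\<^esub> p"
      using r H.rcos_self PN.subgroup_axioms by blast
  next
    fix r assume "r \<in> P N #>\<^bsub>H\<^esub> p"
    then obtain m where "m \<in> carrier H" "h m \<in> N" "r = m \<otimes>\<^bsub>H\<^esub> p"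
      by (auto simp: P_def r_coset_def)
    then show "r \<in> h -` (N #>\<^bsub>G\<^esub> h p) \<inter> carrier H"
      using p by (auto simp: r_coset_def)
  qed
  have rep_y: "\<exists>p\<in>carrier H. y N = N #>\<^bsub>G\<^esub> h p" if "y \<in> carrier (inverse_limit G \<N>)" "N \<in> \<N>" for y N
    using represent[OF that(2)] that by (auto simp: carrier_inverse_limit PiE_iff)
  \<comment> \<open>The result is independent of the choice in \<open>c\<close>: two admissible
    members are compared on a common smaller one.\<close>
  have k_rep: "k y M = M #>\<^bsub>H\<^esub> p"
    if y: "y \<in> carrier (inverse_limit G \<N>)" and "M \<in> \<M>" "N \<in> \<N>" "P N \<subseteq> M" "p \<in> carrier H" "y N = N #>\<^bsub>G\<^esub> h p"
    for y M N p
  proof -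
    obtain N' where N': "N' \<in> \<N>" "N' \<subseteq> N" "N' \<subseteq> c M"
      using directed[OF \<open>N \<in> \<N>\<close> c(1)[OF \<open>M \<in> \<M>\<close>]] by auto
    obtain r where r: "r \<in> carrier H" "y N' = N' #>\<^bsub>G\<^esub> h r"
      using rep_y[OF y N'(1)] by blast
    have "y (c M) = c M #>\<^bsub>G\<^esub> h r"
      using y_up[OF y N'(1) c(1)[OF \<open>M \<in> \<M>\<close>] N'(3) r(2)] r(1) by simp
    then have "k y M = M <#>\<^bsub>H\<^esub> (P (c M) #>\<^bsub>H\<^esub> r)"
      using \<open>M \<in> \<M>\<close> pull[OF c(1) r(1)] by (simp add: k_def)
    then have kM: "k y M = M #>\<^bsub>H\<^esub> r"
      using coset_upH[OF _ P_M[OF c(1)] c(2) r(1)] \<open>M \<in> \<M>\<close> by simp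
    have "y N = N #>\<^bsub>G\<^esub> h r"
      using y_up[OF y N'(1) \<open>N \<in> \<N>\<close> N'(2) r(2)] r(1) by simp
    then have "P N #>\<^bsub>H\<^esub> p = P N #>\<^bsub>H\<^esub> r"
      using eq_coset_iff that r by metis
    then show ?thesis
      using kM coset_upH[OF \<open>M \<in> \<M>\<close> P_M[OF \<open>N \<in> \<N>\<close>] \<open>P N \<subseteq> M\<close>] r \<open>p \<in> carrier H\<close> by metis
  qed
  have k_closed: "k y \<in> carrier (inverse_limit H \<M>)" if y: "y \<in> carrier (inverse_limit G \<N>)" for y
  proof -
    have "k y M \<in> rcosets\<^bsub>H\<^esub> M" if M: "M \<in> \<M>" for M
      using rep_y[OF y c(1)[OF M]] k_rep[OF y M c(1)[OF M] c(2)[OF M]] by (auto simp: RCOSETS_def)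
    moreover have "M' <#>\<^bsub>H\<^esub> k y M = k y M'" if M: "M \<in> \<M>" "M' \<in> \<M>" "M \<subseteq> M'" for M M'
    proof -
      obtain p where p: "p \<in> carrier H" "y (c M) = c M #>\<^bsub>G\<^esub> h p"
        using rep_y[OF y c(1)[OF M(1)]] by blast
      have "P (c M) \<subseteq> M'"
        using c(2)[OF M(1)] M(3) by blast
      then show ?thesis
        using k_rep[OF y M(1) c(1)[OF M(1)] c(2)[OF M(1)] p] k_rep[OF y M(2) c(1)[OF M(1)] _ p]
          coset_upH[OF M(2,1,3) p(1)] by simp
    qed
    moreover have "k y \<in> extensional \<M>"
      by (simp add: k_def)
    ultimately show ?thesis
      by (auto simp: carrier_inverse_limit PiE_iff)
  qed
  have fk: "f (k y) = y" if y: "y \<in> carrier (inverse_limit G \<N>)" for y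
  proof (rule PiE_ext)
    show "f (k y) \<in> (\<Pi>\<^sub>E N\<in>\<N>. rcosets\<^bsub>G\<^esub> N)" "y \<in> (\<Pi>\<^sub>E N\<in>\<N>. rcosets\<^bsub>G\<^esub> N)"
      using f_closed[OF k_closed[OF y]] y by (simp_all add: carrier_inverse_limit)
    fix N assume N: "N \<in> \<N>"
    obtain p where p: "p \<in> carrier H" "y N = N #>\<^bsub>G\<^esub> h p"
      using rep_y[OF y N] by blast
    show "f (k y) N = y N"
      using f_rep[OF N _ p(1)] k_rep[OF y P_M[OF N] N order_refl p] p(2) by metis
  qed
  have kf: "k (f x) = x" if x: "x \<in> carrier (inverse_limit H \<M>)" for x
  proof (rule PiE_ext)
    show "k (f x) \<in> (\<Pi>\<^sub>E M\<in>\<M>. rcosets\<^bsub>H\<^esub> M)" "x \<in> (\<Pi>\<^sub>E M\<in>\<M>. rcosets\<^bsub>H\<^esub> M)"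
      using k_closed[OF f_closed[OF x]] x by (simp_all add: carrier_inverse_limit)
    fix M assume M: "M \<in> \<M>"
    obtain p where p: "p \<in> carrier H" "x (P (c M)) = P (c M) #>\<^bsub>H\<^esub> p"
      using rep_x[OF x P_M[OF c(1)[OF M]]] by blast
    show "k (f x) M = x M"
      using k_rep[OF f_closed[OF x] M c(1)[OF M] c(2)[OF M] p(1) f_rep[where x=x, OF c(1)[OF M] p(2,1)]]
        x_up[OF x P_M[OF c(1)[OF M]] M c(2)[OF M] p(2,1)] by simp
  qed
  have "f (x \<otimes>\<^bsub>inverse_limit H \<M>\<^esub> x') = f x \<otimes>\<^bsub>inverse_limit G \<N>\<^esub> f x'"
    if x: "x \<in> carrier (inverse_limit H \<M>)" and x': "x' \<in> carrier (inverse_limit H \<M>)" for x x'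
  proof (rule PiE_ext)
    have xx': "x \<otimes>\<^bsub>inverse_limit H \<M>\<^esub> x' \<in> carrier (inverse_limit H \<M>)"
      using inverse_limit_mult_closed[OF H normalH] x x' by blast
    show "f (x \<otimes>\<^bsub>inverse_limit H \<M>\<^esub> x') \<in> (\<Pi>\<^sub>E N\<in>\<N>. rcosets\<^bsub>G\<^esub> N)"
      using f_closed[OF xx'] by (simp add: carrier_inverse_limit)
    show "f x \<otimes>\<^bsub>inverse_limit G \<N>\<^esub> f x' \<in> (\<Pi>\<^sub>E N\<in>\<N>. rcosets\<^bsub>G\<^esub> N)"
      using inverse_limit_mult_closed[OF G normalG f_closed[OF x] f_closed[OF x']]
      by (simp add: carrier_inverse_limit)
    fix N assume N: "N \<in> \<N>"
    interpret N: normal N G using normalG[OF N] .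
    interpret PN: normal "P N" H using P_normal[OF N] .
    obtain p p' where p: "p \<in> carrier H" "x (P N) = P N #>\<^bsub>H\<^esub> p" and p': "p' \<in> carrier H" "x' (P N) = P N #>\<^bsub>H\<^esub> p'"
      using rep_x P_M[OF N] x x' by meson
    have "(x \<otimes>\<^bsub>inverse_limit H \<M>\<^esub> x') (P N) = P N #>\<^bsub>H\<^esub> (p \<otimes>\<^bsub>H\<^esub> p')"
      using p p' P_M[OF N] by (simp add: mult_inverse_limit PN.rcos_sum)
    then show "f (x \<otimes>\<^bsub>inverse_limit H \<M>\<^esub> x') N = (f x \<otimes>\<^bsub>inverse_limit G \<N>\<^esub> f x') N"
      using f_rep[OF N] p p' N by (simp add: mult_inverse_limit N.rcos_sum)
  qed
  then have "f \<in> iso (inverse_limit H \<M>) (inverse_limit G \<N>)"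
    using f_closed k_closed fk kf by (auto simp: iso_def hom_def intro!: bij_betw_byWitness[of _ k])
  moreover have "homeomorphic_maps (limit_topology H \<M>) (limit_topology G \<N>) f k"
  proof -
    have "continuous_map (limit_topology H \<M>) (limit_topology G \<N>) f"
    proof (rule continuous_map_into_limit)
      fix N assume "N \<in> \<N>"
      then show "\<exists>M\<in>\<M>. \<exists>\<phi>. \<forall>x\<in>carrier (inverse_limit H \<M>). f x N = \<phi> (x M)"
        by (intro bexI[OF _ P_M] exI[of _ "\<lambda>X. N <#>\<^bsub>G\<^esub> h ` X"]) (auto simp: f_def)
    qed (use f_closed in auto)
    moreover have "continuous_map (limit_topology G \<N>) (limit_topology H \<M>) k"
    proof (rule continuous_map_into_limit)
      fix M assume "M \<in> \<M>"
      then show "\<exists>N\<in>\<N>. \<exists>\<phi>. \<forall>y\<in>carrier (inverse_limit G \<N>). k y M = \<phi> (y N)"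
        by (intro bexI[OF _ c(1)] exI[of _ "\<lambda>Y. M <#>\<^bsub>H\<^esub> (h -` Y \<inter> carrier H)"]) (auto simp: k_def)
    qed (use k_closed in auto)
    ultimately show ?thesis
      by (simp add: homeomorphic_maps_def fk kf)
  qed
  ultimately show ?thesis
    unfolding limits_isomorphic_def using homeomorphic_map_maps by blast
qed

text \<open>Compose the first isomorphism with the topological inverse of the second, which is
  multiplicative because \<open>f'\<close> is multiplicative and injective.\<close>

lemma isomorphic_profinite_completions_common_limit:
  assumes "group H'"
    and "limits_isomorphic H (finite_index_normals H) G \<N>"
    and "limits_isomorphic H' (finite_index_normals H') G \<N>"
  shows "isomorphic_profinite_completions H H'"
proof -
  obtain f where f: "f \<in> iso (profinite_completion H) (inverse_limit G \<N>)"
      "homeomorphic_map (profinite_topology H) (limit_topology G \<N>) f"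
    using assms(2) by (auto simp: limits_isomorphic_def profinite_completion_eq_inverse_limit profinite_topology_eq_limit_topology)
  obtain f' where f': "f' \<in> iso (profinite_completion H') (inverse_limit G \<N>)"
      "homeomorphic_map (profinite_topology H') (limit_topology G \<N>) f'"
    using assms(3) by (auto simp: limits_isomorphic_def profinite_completion_eq_inverse_limit profinite_topology_eq_limit_topology)
  obtain k where k: "homeomorphic_maps (profinite_topology H') (limit_topology G \<N>) f' k"
    using f'(2) homeomorphic_map_maps by blast
  have mult_closed: "x \<otimes>\<^bsub>profinite_completion H'\<^esub> y \<in> carrier (profinite_completion H')"
    if "x \<in> carrier (profinite_completion H')" "y \<in> carrier (profinite_completion H')" for x y
    using that inverse_limit_mult_closed[OF assms(1), of "finite_index_normals H'"]
    unfolding profinite_completion_eq_inverse_limit by (auto simp: finite_index_normals_def)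
  have k_iso: "k \<in> iso (inverse_limit G \<N>) (profinite_completion H')"
  proof -
    have top: "topspace (profinite_topology H') = carrier (profinite_completion H')"
      by (simp add: profinite_topology_eq_limit_topology profinite_completion_eq_inverse_limit)
    have kin: "k y \<in> carrier (profinite_completion H')" "f' (k y) = y" if "y \<in> carrier (inverse_limit G \<N>)" for y
      using k that by (auto simp: homeomorphic_maps_def top continuous_map_def)
    have f'in: "f' x \<in> carrier (inverse_limit G \<N>)" "k (f' x) = x" if "x \<in> carrier (profinite_completion H')" for x
      using k that by (auto simp: homeomorphic_maps_def top continuous_map_def)
    have "k (y \<otimes>\<^bsub>inverse_limit G \<N>\<^esub> y') = k y \<otimes>\<^bsub>profinite_completion H'\<^esub> k y'"
      if "y \<in> carrier (inverse_limit G \<N>)" "y' \<in> carrier (inverse_limit G \<N>)" for y y'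
    proof -
      have "f' (k y \<otimes>\<^bsub>profinite_completion H'\<^esub> k y') = y \<otimes>\<^bsub>inverse_limit G \<N>\<^esub> y'"
        using f'(1) kin that hom_mult[of f' "profinite_completion H'" "inverse_limit G \<N>" "k y" "k y'"]
        by (simp add: iso_def)
      then show ?thesis
        using f'in(2) mult_closed kin that by metis
    qed
    then show ?thesis
      using kin f'in by (auto simp: iso_def hom_def intro!: bij_betw_byWitness[of _ f'])
  qed
  have "k \<circ> f \<in> iso (profinite_completion H) (profinite_completion H')"
    using iso_set_trans[OF f(1) k_iso] by (simp add: comp_def compose_def)
  moreover have "homeomorphic_map (profinite_topology H) (profinite_topology H') (k \<circ> f)"
    using f(2) k homeomorphic_map_compose homeomorphic_map_maps homeomorphic_maps_sym by metis
  ultimately show ?thesis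
    unfolding isomorphic_profinite_completions_def by blast
qed

section \<open>An integer sequence with long gaps modulo every prime\<close>

definition nth_prime :: "nat \<Rightarrow> int" where
  "nth_prime l = int (enumerate {p. prime p} l)"

definition primorial :: "nat \<Rightarrow> int" where
  "primorial l = (\<Prod>i<l. nth_prime i)"

text \<open>The powers of 2 make each centre \<open>2 * radius (Suc l)\<close> a multiple of the
  previous period \<open>4 * radius l\<close>. The factorial makes every positive integer divide
  \<open>radius l\<close> for all large \<open>l\<close>.\<close>

definition radius :: "nat \<Rightarrow> int" where
  "radius l = 2 ^ l * fact l"

lemma prime_nth_prime [simp]: "prime (nth_prime l)"
  using enumerate_in_set[OF primes_infinite, of l] by (simp add: nth_prime_def)

lemma nth_prime_eq_iff [simp]: "nth_prime i = nth_prime j \<longleftrightarrow> i = j"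
  using bij_enumerate[OF primes_infinite] by (auto simp: nth_prime_def bij_betw_def inj_def)

lemma nth_prime_surj:
  assumes "prime (p::int)" shows "\<exists>l. nth_prime l = p"
proof -
  have "nat p \<in> enumerate {p. prime p} ` UNIV"
    using assms range_enumerate[OF primes_infinite] by simp
  then obtain l where "enumerate {p. prime p} l = nat p"
    by auto
  then show ?thesis
    using assms prime_ge_0_int[of p] by (auto simp: nth_prime_def intro!: exI[of _ l])
qed

lemma coprime_nth_prime: "i \<noteq> j \<Longrightarrow> coprime (nth_prime i) (nth_prime j)"
  by (simp add: primes_coprime)

lemma nth_prime_dvd_primorial: "i < l \<Longrightarrow> nth_prime i dvd primorial l"
  by (auto simp: primorial_def intro: dvd_prodI)

lemma primorial_Suc: "primorial (Suc l) = primorial l * nth_prime l"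
  by (simp add: primorial_def)

lemma coprime_primorial: "coprime (primorial l) (nth_prime l)"
  by (auto simp: primorial_def intro!: prod_coprime_left coprime_nth_prime)

lemma primorial_pos: "primorial l > 0"
  unfolding primorial_def by (intro prod_pos) (simp add: prime_gt_0_int)

lemma primorial_dvd_iff: "primorial l dvd z \<longleftrightarrow> (\<forall>i<l. nth_prime i dvd z)"
proof
  assume "\<forall>i<l. nth_prime i dvd z"
  then show "primorial l dvd z"
    by (induction l) (auto simp: primorial_Suc primorial_def[of 0] intro: divides_mult coprime_primorial)
qed (auto intro: dvd_trans[OF nth_prime_dvd_primorial])

lemma radius_pos: "radius l > 0"
  by (simp add: radius_def)

lemma radius_Suc: "radius (Suc l) = 2 * (int l + 1) * radius l"
  by (simp add: radius_def algebra_simps)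

lemma radius_gt: "radius l > int l"
proof (induction l)
  case (Suc l)
  have "radius (Suc l) \<ge> 2 * radius l"
    using radius_pos[of l] by (simp add: radius_Suc)
  then show ?case
    using Suc radius_pos[of l] by simp
qed (simp add: radius_def)

lemma radius_mono: "l \<le> m \<Longrightarrow> radius l \<le> radius m"
proof (induction m rule: dec_induct)
  case (step m)
  moreover have "1 * radius m \<le> 2 * (int m + 1) * radius m"
    using radius_pos[of m] by (intro mult_right_mono) auto
  ultimately show ?case
    by (simp add: radius_Suc)
qed simp

lemma radius_dvd: "l \<le> m \<Longrightarrow> radius l dvd radius m"
  by (induction m rule: dec_induct) (auto simp: radius_Suc intro: dvd_mult)

lemma dvd_radius: "0 < d \<Longrightarrow> d \<le> int l \<Longrightarrow> d dvd radius l"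
proof -
  assume d: "0 < d" "d \<le> int l"
  then have "nat d dvd fact l"
    by (intro dvd_fact) auto
  then have "d dvd int (fact l)"
    using d by (metis int_dvd_int_iff int_nat_eq less_imp_le)
  then show ?thesis
    by (simp add: radius_def)
qed

text \<open>Multiplying by this integer makes a value vanish modulo the new prime and leaves it
  unchanged modulo all earlier ones.\<close>

definition crt_factor :: "nat \<Rightarrow> int" where
  "crt_factor l = (SOME w. [w = 1] (mod primorial l) \<and> [w = 0] (mod nth_prime l))"

lemma crt_factor: "[crt_factor l = 1] (mod primorial l)" "[crt_factor l = 0] (mod nth_prime l)"
  using someI_ex[OF binary_chinese_remainder_int[OF coprime_primorial, of 1 l 0]]
  by (auto simp: crt_factor_def)

text \<open>
  \<open>stage (Suc l)\<close> has period \<open>4 * radius l\<close> and agrees with \<open>stage l\<close> modulo \<open>primorial l\<close>. The two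
  differ only on the window around the centre \<open>2 * radius l\<close> of each period, where \<open>stage (Suc l)\<close> is
  made to vanish modulo \<open>nth_prime l\<close> away from the centre. This window avoids a neighbourhood of 0 that
  grows with \<open>l\<close>, so the stages stabilise pointwise.
\<close>

primrec stage :: "nat \<Rightarrow> int \<Rightarrow> int" where
  "stage 0 k = 0"
| "stage (Suc l) k =
     (let e = k mod (4 * radius l) in
      if radius l < e \<and> e < 3 * radius l
      then if e = 2 * radius l then primorial l else stage l k * crt_factor l
      else stage l k)"

text \<open>Stage \<open>nat \<bar>k\<bar>\<close> is already final at \<open>k\<close>, because
  \<open>radius l\<close> exceeds \<open>l\<close>.\<close>

definition gap_seq :: "int \<Rightarrow> int" where
  "gap_seq k = stage (nat \<bar>k\<bar>) k"

lemma stage_periodic: "[k = k'] (mod 4 * radius l) \<Longrightarrow> stage (Suc l) k = stage (Suc l) k'"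
proof (induction l arbitrary: k k')
  case 0
  then show ?case by (simp add: cong_def Let_def)
next
  case (Suc l)
  have "4 * radius l dvd 4 * radius (Suc l)"
    using radius_dvd[of l "Suc l"] by (intro mult_dvd_mono) auto
  then have "[k = k'] (mod 4 * radius l)"
    by (rule cong_dvd_modulus[OF Suc.prems])
  then have "stage (Suc l) k = stage (Suc l) k'"
    by (rule Suc.IH)
  moreover have "k mod (4 * radius (Suc l)) = k' mod (4 * radius (Suc l))"
    using Suc.prems by (simp add: cong_def)
  ultimately show ?case
    by (simp only: stage.simps(2)[of "Suc l"])
qed

lemma stage_zero: "stage l 0 = 0"
proof (induction l)
  case (Suc l)
  then show ?case
    using radius_pos[of l] by (simp add: Let_def)
qed simp

text \<open>The centre is a multiple of the period of \<open>stage l\<close>, so the value is the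
  one at 0. Hence overwriting it by \<open>primorial l\<close> changes nothing modulo the earlier
  primes.\<close>

lemma stage_centre_lower: "stage l (2 * radius l) = 0"
proof (cases l)
  case (Suc m)
  have "2 * radius l = 4 * radius m * (int m + 1)"
    by (simp add: Suc radius_Suc)
  then have "[2 * radius l = 0] (mod 4 * radius m)"
    by (simp add: cong_0_iff)
  then show ?thesis
    using stage_periodic[of "2 * radius l" 0 m] stage_zero by (simp only: Suc)
qed simp

lemma stage_window:
  assumes "\<bar>k\<bar> < radius l"
  shows "(2 * radius l + k) mod (4 * radius l) = 2 * radius l + k"
  using assms radius_pos[of l] by (intro mod_pos_pos_trivial) auto

lemma stage_centre: "stage (Suc l) (2 * radius l) = primorial l"
  using stage_window[of 0 l] radius_pos[of l] by (simp add: Let_def)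

lemma stage_Suc_cong: "[stage (Suc l) k = stage l k] (mod primorial l)"
proof (cases "k mod (4 * radius l) = 2 * radius l")
  case True
  then have "stage l k = 0"
  proof (cases l)
    case (Suc m)
    have "[k = 2 * radius l] (mod 4 * radius l)"
      using True radius_pos[of l] by (simp add: cong_def)
    then have "[k = 2 * radius l] (mod 4 * radius m)"
      by (rule cong_dvd_modulus) (use Suc radius_dvd[of m l] in auto)
    then show ?thesis
      using stage_periodic[of k "2 * radius l" m] stage_centre_lower[of l] by (simp only: Suc)
  qed simp
  then show ?thesis
    using True radius_pos[of l] by (simp add: Let_def cong_0_iff)
next
  case False
  have "[stage l k * crt_factor l = stage l k * 1] (mod primorial l)"
    using crt_factor(1) by (intro cong_mult) auto
  then show ?thesis
    using False by (simp add: Let_def)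
qed

text \<open>Modulo the period, a small \<open>k\<close> lies in the first or the last quarter, and
  later stages change only the two middle quarters.\<close>

lemma stage_stable:
  assumes "\<bar>k\<bar> \<le> radius l" "l \<le> m"
  shows "stage m k = stage l k"
  using assms(2)
proof (induction m rule: dec_induct)
  case (step m)
  have "\<bar>k\<bar> \<le> radius m"
    using assms radius_mono[of l m] step by simp
  moreover have "k mod (4 * radius m) \<le> radius m \<or> 3 * radius m \<le> k mod (4 * radius m)"
  proof (cases "k \<ge> 0")
    case True
    then have "k mod (4 * radius m) = k"
      using \<open>\<bar>k\<bar> \<le> radius m\<close> radius_pos[of m] by (intro mod_pos_pos_trivial) auto
    then show ?thesis
      using True \<open>\<bar>k\<bar> \<le> radius m\<close> by simp
  next
    case False
    then have "(k + 4 * radius m) mod (4 * radius m) = k + 4 * radius m"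
      using \<open>\<bar>k\<bar> \<le> radius m\<close> radius_pos[of m] by (intro mod_pos_pos_trivial) auto
    then show ?thesis
      using False \<open>\<bar>k\<bar> \<le> radius m\<close> by simp
  qed
  ultimately show ?case
    using step by (auto simp: Let_def)
qed simp

lemma gap_seq_eq_stage:
  assumes "\<bar>k\<bar> \<le> radius l"
  shows "gap_seq k = stage l k"
proof -
  have "\<bar>k\<bar> \<le> radius (nat \<bar>k\<bar>)"
    using radius_gt[of "nat \<bar>k\<bar>"] by simp
  then show ?thesis
    using stage_stable[OF assms, of "max l (nat \<bar>k\<bar>)"] stage_stable[of k "nat \<bar>k\<bar>" "max l (nat \<bar>k\<bar>)"]
    by (simp add: gap_seq_def)
qed

lemma gap_seq_cong_stage: "[gap_seq k = stage l k] (mod primorial l)"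
proof -
  define m where "m = max l (nat \<bar>k\<bar>)"
  have "[stage m k = stage l k] (mod primorial l)" if "l \<le> m" for m
    using that
  proof (induction m rule: dec_induct)
    case (step m)
    have "primorial l dvd primorial m"
      using step by (auto simp: primorial_dvd_iff nth_prime_dvd_primorial)
    then have "[stage (Suc m) k = stage m k] (mod primorial l)"
      by (rule cong_dvd_modulus[OF stage_Suc_cong])
    then show ?case
      using step cong_trans by blast
  qed simp
  moreover have "gap_seq k = stage m k"
    using radius_gt[of m] by (intro gap_seq_eq_stage) (simp add: m_def max_def split: if_splits)
  ultimately show ?thesis
    by (simp add: m_def)
qed

lemma gap_seq_zero: "gap_seq 0 = 0"
  by (simp add: gap_seq_def)

text \<open>Modulo \<open>nth_prime l\<close> the sequence is already settled by
  \<open>stage (Suc l)\<close>, whose period divides \<open>4 * radius X\<close>.\<close>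

lemma gap_seq_periodic:
  assumes "l < X" "4 * radius X dvd k - k'"
  shows "[gap_seq k = gap_seq k'] (mod nth_prime l)"
proof -
  have "4 * radius l dvd 4 * radius X"
    using assms radius_dvd[of l X] by (intro mult_dvd_mono) auto
  then have "[k = k'] (mod 4 * radius l)"
    using assms(2) by (auto simp: cong_iff_dvd_diff intro: dvd_trans)
  then have "stage (Suc l) k = stage (Suc l) k'"
    by (rule stage_periodic)
  then have "[gap_seq k = gap_seq k'] (mod primorial (Suc l))"
    using gap_seq_cong_stage[of k "Suc l"] gap_seq_cong_stage[of k' "Suc l"] by (simp only: cong_def)
  then show ?thesis
    by (rule cong_dvd_modulus) (simp add: nth_prime_dvd_primorial)
qed

lemma gap_seq_centre: "gap_seq (2 * radius l) = primorial l"
proof -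
  have "\<bar>2 * radius l\<bar> \<le> radius (Suc l)"
    using radius_pos[of l] by (simp add: radius_Suc mult_right_mono)
  then show ?thesis
    using gap_seq_eq_stage[of "2 * radius l" "Suc l"] stage_centre by (simp only:)
qed

lemma gap_seq_near_centre:
  assumes "k \<noteq> 0" "\<bar>k\<bar> < radius l"
  shows "nth_prime l dvd gap_seq (2 * radius l + k)"
proof -
  have "stage (Suc l) (2 * radius l + k) = stage l (2 * radius l + k) * crt_factor l"
    using assms stage_window[OF assms(2)] by (auto simp: Let_def)
  then have "nth_prime l dvd stage (Suc l) (2 * radius l + k)"
    using crt_factor(2)[of l] by (simp add: cong_0_iff)
  moreover have "[gap_seq (2 * radius l + k) = stage (Suc l) (2 * radius l + k)] (mod nth_prime l)"
    by (rule cong_dvd_modulus[OF gap_seq_cong_stage]) (simp add: nth_prime_dvd_primorial)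
  ultimately show ?thesis
    by (simp only: cong_dvd_iff)
qed

section \<open>Laurent polynomials\<close>

type_synonym laurent = "int \<Rightarrow>\<^sub>0 int"

abbreviation tpow :: "int \<Rightarrow> laurent" where
  "tpow n \<equiv> Poly_Mapping.single n 1"

lemma tpow_add: "tpow (m + n) = tpow m * tpow n"
  by (simp add: Poly_Mapping.mult_single)

lemma tpow_cancel [simp]: "tpow n * tpow (- n) = 1" "tpow (- n) * tpow n = 1"
  "tpow n * (tpow (- n) * r) = r" "tpow (- n) * (tpow n * r) = r"
  by (simp_all add: Poly_Mapping.mult_single flip: mult.assoc)

lemma single_eq_of_int_mult: "Poly_Mapping.single k z = of_int z * tpow k"
  by (simp add: Poly_Mapping.mult_single flip: Poly_Mapping.single_of_int)

lemma laurent_induct [case_names single add]: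
  fixes r :: laurent
  assumes "\<And>k z. P (Poly_Mapping.single k z)" "\<And>r s. P r \<Longrightarrow> P s \<Longrightarrow> P (r + s)"
  shows "P r"
proof (induction r rule: update_induct)
  case const
  then show ?case
    using assms(1)[of 0 0] by simp
next
  case (update f a b)
  have "Poly_Mapping.update a b f = f + Poly_Mapping.single a b"
    using update(1) by (intro poly_mapping_eqI) (auto simp: Poly_Mapping.lookup_update Poly_Mapping.lookup_add Poly_Mapping.lookup_single in_keys_iff when_def)
  then show ?case
    using assms update by simp
qed

definition pairing :: "(int \<Rightarrow> int) \<Rightarrow> laurent \<Rightarrow> int" where
  "pairing p r = (\<Sum>k\<in>Poly_Mapping.keys r. Poly_Mapping.lookup r k * p k)"

lemma pairing_superset:
  assumes "finite A" "Poly_Mapping.keys r \<subseteq> A"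
  shows "pairing p r = (\<Sum>k\<in>A. Poly_Mapping.lookup r k * p k)"
  unfolding pairing_def using assms by (intro sum.mono_neutral_left) (auto simp: in_keys_iff)

lemma pairing_add: "pairing p (r + s) = pairing p r + pairing p s"
proof -
  define A where "A = Poly_Mapping.keys r \<union> Poly_Mapping.keys s"
  have "finite A" "Poly_Mapping.keys r \<subseteq> A" "Poly_Mapping.keys s \<subseteq> A" "Poly_Mapping.keys (r + s) \<subseteq> A"
    using Poly_Mapping.keys_add[of r s] by (auto simp: A_def)
  then show ?thesis
    by (simp add: pairing_superset[of A] Poly_Mapping.lookup_add algebra_simps sum.distrib)
qed

lemma pairing_single [simp]: "pairing p (Poly_Mapping.single k z) = z * p k"
  by (simp add: pairing_def)

lemma pairing_zero [simp]: "pairing p 0 = 0"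
  by (simp add: pairing_def)

lemma pairing_minus: "pairing p (- r) = - pairing p r"
  using pairing_add[of p r "- r"] by simp

lemma pairing_diff: "pairing p (r - s) = pairing p r - pairing p s"
  using pairing_add[of p r "- s"] by (simp add: pairing_minus)

lemma pairing_of_int_mult: "pairing p (of_int z * r) = z * pairing p r"
proof (induction r rule: laurent_induct)
  case (single k y)
  then show ?case
    by (simp add: Poly_Mapping.mult_single flip: Poly_Mapping.single_of_int)
qed (simp add: pairing_add algebra_simps)

lemma pairing_shift: "pairing p (tpow n * r) = pairing (\<lambda>k. p (n + k)) r"
  by (induction r rule: laurent_induct) (auto simp: Poly_Mapping.mult_single pairing_add distrib_left)

lemma pairing_cong:
  assumes "\<And>k. k \<in> Poly_Mapping.keys r \<Longrightarrow> [p k = p' k] (mod q)"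
  shows "[pairing p r = pairing p' r] (mod q)"
  unfolding pairing_def using assms by (intro cong_sum cong_mult cong_refl) auto

section \<open>The ideals generated by an integer and t^m - 1\<close>

definition cong_ideal :: "int \<Rightarrow> int \<Rightarrow> laurent set" where
  "cong_ideal d m = {of_int d * u + (tpow m - 1) * v | u v. True}"

lemma cong_idealI: "r = of_int d * u + (tpow m - 1) * v \<Longrightarrow> r \<in> cong_ideal d m"
  by (auto simp: cong_ideal_def)

lemma cong_ideal_add: "r \<in> cong_ideal d m \<Longrightarrow> s \<in> cong_ideal d m \<Longrightarrow> r + s \<in> cong_ideal d m"
proof -
  assume "r \<in> cong_ideal d m" "s \<in> cong_ideal d m"
  then obtain u v u' v' where "r = of_int d * u + (tpow m - 1) * v" "s = of_int d * u' + (tpow m - 1) * v'"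
    by (auto simp: cong_ideal_def)
  then have "r + s = of_int d * (u + u') + (tpow m - 1) * (v + v')"
    by (simp only: distrib_left add_ac)
  then show ?thesis by (rule cong_idealI)
qed

lemma cong_ideal_mult: "r \<in> cong_ideal d m \<Longrightarrow> s * r \<in> cong_ideal d m"
proof -
  assume "r \<in> cong_ideal d m"
  then obtain u v where "r = of_int d * u + (tpow m - 1) * v"
    by (auto simp: cong_ideal_def)
  then have "s * r = of_int d * (s * u) + (tpow m - 1) * (s * v)"
    by (simp only: distrib_left mult.left_commute)
  then show ?thesis by (rule cong_idealI)
qed

lemma cong_ideal_zero [simp]: "0 \<in> cong_ideal d m"
  by (rule cong_idealI[of _ _ 0 _ 0]) simp

lemma cong_ideal_minus: "r \<in> cong_ideal d m \<Longrightarrow> - r \<in> cong_ideal d m"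
  using cong_ideal_mult[of r d m "-1"] by simp

lemma cong_ideal_diff: "r \<in> cong_ideal d m \<Longrightarrow> s \<in> cong_ideal d m \<Longrightarrow> r - s \<in> cong_ideal d m"
  using cong_ideal_add[of r d m "- s"] cong_ideal_minus by simp

lemma cong_ideal_sum: "(\<And>i. i \<in> A \<Longrightarrow> f i \<in> cong_ideal d m) \<Longrightarrow> (\<Sum>i\<in>A. f i) \<in> cong_ideal d m"
  by (induction A rule: infinite_finite_induct) (auto intro: cong_ideal_add)

lemma cong_ideal_of_int: "d dvd z \<Longrightarrow> of_int z * r \<in> cong_ideal d m"
proof -
  assume "d dvd z"
  then obtain y where "z = d * y" by auto
  then show ?thesis
    by (intro cong_idealI[of _ d "of_int y * r" m 0]) simp
qed

lemma tpow_minus_1_mult_nat: "tpow (m * int n) - 1 \<in> cong_ideal d m"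
proof (induction n)
  case (Suc n)
  have "tpow (m * int (Suc n)) - 1 = tpow m * (tpow (m * int n) - 1) + (tpow m - 1)"
    by (simp add: algebra_simps Poly_Mapping.mult_single)
  moreover have "tpow m - 1 \<in> cong_ideal d m"
    by (rule cong_idealI[of _ _ 0 _ 1]) simp
  ultimately show ?case
    using cong_ideal_add[OF cong_ideal_mult[OF Suc]] by (simp only:)
qed simp

lemma tpow_minus_1_in_cong_ideal: "m dvd n \<Longrightarrow> tpow n - 1 \<in> cong_ideal d m"
proof -
  assume "m dvd n"
  then obtain j where n: "n = m * j" by auto
  show ?thesis
  proof (cases "j \<ge> 0")
    case True
    then show ?thesis
      using tpow_minus_1_mult_nat[of m "nat j" d] n by simp
  next
    case False
    then have "tpow (- n) - 1 \<in> cong_ideal d m"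
      using tpow_minus_1_mult_nat[of m "nat (- j)" d] n by simp
    then have "(- tpow n) * (tpow (- n) - 1) \<in> cong_ideal d m"
      by (rule cong_ideal_mult)
    then show ?thesis
      by (simp add: algebra_simps Poly_Mapping.mult_single)
  qed
qed

lemma cong_ideal_mono:
  assumes "d' dvd d" "m' dvd m"
  shows "cong_ideal d m \<subseteq> cong_ideal d' m'"
proof
  fix r assume "r \<in> cong_ideal d m"
  then obtain u v where r: "r = of_int d * u + (tpow m - 1) * v"
    by (auto simp: cong_ideal_def)
  have "v * (tpow m - 1) \<in> cong_ideal d' m'"
    using tpow_minus_1_in_cong_ideal[OF assms(2)] by (rule cong_ideal_mult)
  then show "r \<in> cong_ideal d' m'"
    unfolding r using assms(1) by (intro cong_ideal_add cong_ideal_of_int) (simp_all add: mult.commute)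
qed

lemma cong_ideal_tpow_iff [simp]: "tpow n * r \<in> cong_ideal d m \<longleftrightarrow> r \<in> cong_ideal d m"
  using cong_ideal_mult[of r d m "tpow n"] cong_ideal_mult[of "tpow n * r" d m "tpow (- n)"] by auto

text \<open>Modulo t^m - 1, both b * r and a * r are multiples of a * b, and a Bezout combination of
  them is r. This merges the conditions at separate primes into one modulo
  \<open>primorial X ^ X\<close>.\<close>

lemma cong_ideal_coprime:
  assumes "coprime a b" "r \<in> cong_ideal a m" "r \<in> cong_ideal b m"
  shows "r \<in> cong_ideal (a * b) m"
proof -
  obtain x y where xy: "x * a + y * b = 1"
    using assms(1) bezout_int[of a b] by (metis coprime_imp_gcd_eq_1)
  obtain u v where 1: "r = of_int a * u + (tpow m - 1) * v"
    using assms(2) by (auto simp: cong_ideal_def)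
  obtain u' v' where 2: "r = of_int b * u' + (tpow m - 1) * v'"
    using assms(3) by (auto simp: cong_ideal_def)
  have "of_int b * r = of_int (a * b) * u + (tpow m - 1) * (of_int b * v)"
    by (simp add: 1 algebra_simps)
  moreover have "of_int a * r = of_int (a * b) * u' + (tpow m - 1) * (of_int a * v')"
    by (subst 2) (simp add: algebra_simps)
  ultimately have "of_int y * (of_int b * r) \<in> cong_ideal (a * b) m" "of_int x * (of_int a * r) \<in> cong_ideal (a * b) m"
    by (metis cong_ideal_mult cong_idealI)+
  then have "of_int y * (of_int b * r) + of_int x * (of_int a * r) \<in> cong_ideal (a * b) m"
    by (rule cong_ideal_add)
  moreover have "of_int y * (of_int b * r) + of_int x * (of_int a * r) = of_int (x * a + y * b) * r"
    by (simp add: algebra_simps)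
  ultimately show ?thesis
    using xy by simp
qed

text \<open>Periodicity of \<open>p\<close> modulo \<open>q\<close> is what makes the functional
  kill multiples of t^m - 1 modulo \<open>q\<close>.\<close>

lemma pairing_cong_ideal:
  assumes "r \<in> cong_ideal d m" "q dvd d" "\<And>k. [p (m + k) = p k] (mod q)"
  shows "q dvd pairing p r"
proof -
  obtain u v where r: "r = of_int d * u + (tpow m - 1) * v"
    using assms(1) by (auto simp: cong_ideal_def)
  have "[pairing (\<lambda>k. p (m + k)) v = pairing p v] (mod q)"
    using assms(3) by (rule pairing_cong)
  then have "q dvd pairing (\<lambda>k. p (m + k)) v - pairing p v"
    by (simp add: cong_iff_dvd_diff)
  then show ?thesis
    using assms(2) by (simp add: r pairing_add pairing_of_int_mult left_diff_distrib pairing_diff pairing_shift)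
qed

text \<open>Exponents can be reduced modulo \<open>m\<close> and coefficients modulo
  \<open>d\<close>, which leaves the finitely many polynomials of \<open>F\<close>.\<close>

lemma cong_ideal_finite_index:
  assumes "d > 0" "m > 0"
  obtains F where "finite F" "\<And>r. \<exists>f\<in>F. r - f \<in> cong_ideal d m"
proof
  define S where "S c = (\<Sum>k\<in>{0..<m}. Poly_Mapping.single k (c k :: int))" for c
  define F where "F = S ` ({0..<m} \<rightarrow>\<^sub>E {0..<d})"
  show "finite F"
    by (simp add: F_def finite_PiE)
  have add: "S c + S c' = S (\<lambda>k. c k + c' k)" for c c'
    by (simp add: S_def Poly_Mapping.single_add sum.distrib)
  fix r
  have "\<exists>c. r - S c \<in> cong_ideal d m"
  proof (induction r rule: laurent_induct)
    case (single k z)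
    define c where "c = (\<lambda>i. if i = k mod m then z else 0)"
    have "S c = (\<Sum>i\<in>{0..<m}. if i = k mod m then Poly_Mapping.single i z else 0)"
      unfolding S_def by (intro sum.cong) (auto simp: c_def)
    also have "\<dots> = Poly_Mapping.single (k mod m) z"
      using assms by simp
    finally have "Poly_Mapping.single k z - S c = of_int z * tpow (k mod m) * (tpow (k - k mod m) - 1)"
      by (simp add: algebra_simps Poly_Mapping.mult_single flip: Poly_Mapping.single_of_int)
    moreover have "tpow (k - k mod m) - 1 \<in> cong_ideal d m"
      by (rule tpow_minus_1_in_cong_ideal) (simp add: minus_mod_eq_mult_div)
    ultimately show ?case
      using cong_ideal_mult by metis
  next
    case (add r s)
    then obtain c c' where "r - S c \<in> cong_ideal d m" "s - S c' \<in> cong_ideal d m" by blast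
    then have "(r - S c) + (s - S c') \<in> cong_ideal d m"
      by (rule cong_ideal_add)
    moreover have "(r - S c) + (s - S c') = (r + s) - S (\<lambda>k. c k + c' k)"
      by (simp flip: \<open>\<And>c c'. S c + S c' = S (\<lambda>k. c k + c' k)\<close>)
    ultimately show ?case by metis
  qed
  then obtain c where c: "r - S c \<in> cong_ideal d m" by blast
  define c' where "c' = (\<lambda>k\<in>{0..<m}. c k mod d)"
  have "S c - S c' = (\<Sum>k\<in>{0..<m}. of_int (c k - c' k) * tpow k)"
    by (simp only: S_def sum_subtractf[symmetric] Poly_Mapping.single_diff[symmetric] single_eq_of_int_mult[symmetric])
  also have "\<dots> \<in> cong_ideal d m"
    by (intro cong_ideal_sum cong_ideal_of_int) (auto simp: c'_def)
  finally have "(r - S c) + (S c - S c') \<in> cong_ideal d m"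
    using c by (intro cong_ideal_add)
  moreover have "S c' \<in> F"
    using assms unfolding F_def by (intro imageI) (auto simp: c'_def)
  ultimately show "\<exists>f\<in>F. r - f \<in> cong_ideal d m"
    by (intro bexI[of _ "S c'"]) auto
qed

text \<open>The sum of the coefficients at exponents congruent to k modulo m is divisible by d on
  the ideal. For m beyond all distances from k to exponents of r this sum is one nonzero
  coefficient, and a large d cannot divide it.\<close>

lemma cong_ideal_separated:
  assumes "r \<noteq> 0"
  obtains B where "\<And>d m. d > B \<Longrightarrow> m > B \<Longrightarrow> r \<notin> cong_ideal d m"
proof -
  obtain k where k: "Poly_Mapping.lookup r k \<noteq> 0"
    using assms by (metis Poly_Mapping.lookup_zero poly_mapping_eqI)
  define B where "B = \<bar>Poly_Mapping.lookup r k\<bar> + (\<Sum>i\<in>Poly_Mapping.keys r. \<bar>i - k\<bar>)"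
  have "r \<notin> cong_ideal d m" if dm: "d > B" "m > B" for d m
  proof
    assume r: "r \<in> cong_ideal d m"
    define p where "p i = (if m dvd i - k then 1 else 0 :: int)" for i
    have nonneg: "(\<Sum>i\<in>Poly_Mapping.keys r. \<bar>i - k\<bar>) \<ge> 0"
      by (intro sum_nonneg) auto
    have p: "p i = (if i = k then 1 else 0)" if i: "i \<in> Poly_Mapping.keys r" for i
    proof (cases "i = k")
      case False
      have "\<bar>i - k\<bar> \<le> (\<Sum>i\<in>Poly_Mapping.keys r. \<bar>i - k\<bar>)"
        using i by (intro member_le_sum) auto
      then have "\<bar>i - k\<bar> < m"
        using dm by (simp add: B_def)
      then show ?thesis
        using False dvd_imp_le_int[of "i - k" m] by (auto simp: p_def)
    qed (simp add: p_def)
    have "pairing p r = (\<Sum>i\<in>Poly_Mapping.keys r. if i = k then Poly_Mapping.lookup r k else 0)"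
      unfolding pairing_def by (intro sum.cong) (auto simp: p)
    also have "\<dots> = Poly_Mapping.lookup r k"
      using k by (simp add: in_keys_iff)
    finally have "pairing p r = Poly_Mapping.lookup r k" .
    moreover have "d dvd pairing p r"
    proof (rule pairing_cong_ideal[OF r dvd_refl])
      fix i
      have "m dvd m + i - k \<longleftrightarrow> m dvd i - k"
        using dvd_add_right_iff[of m m "i - k"] by (simp add: algebra_simps)
      then show "[p (m + i) = p i] (mod d)"
        by (simp add: p_def)
    qed
    ultimately have "\<bar>d\<bar> \<le> \<bar>Poly_Mapping.lookup r k\<bar>"
      using k by (intro dvd_imp_le_int) simp_all
    then show False
      using dm nonneg unfolding B_def by linarith
  qed
  then show ?thesis using that by blast
qed

lemma tpow_fixed_imp_zero:
  assumes "tpow n * r = r" "n \<noteq> 0"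
  shows "r = 0"
proof -
  have "(tpow n - 1) * r = 0"
    using assms(1) by (simp add: left_diff_distrib)
  moreover have "tpow n - 1 \<noteq> 0"
    using assms(2) by (metis Poly_Mapping.lookup_single_not_eq Poly_Mapping.lookup_single_eq right_minus_eq Poly_Mapping.single_one zero_neq_one)
  ultimately show ?thesis
    by simp
qed

section \<open>The ambient group and its congruence subgroups\<close>

definition alt :: "int \<Rightarrow> int" where
  "alt n = (if even n then 1 else - 1)"

text \<open>These are the powers of -1/t, written as monomials. The sign is what will make t invert
  the c coordinate.\<close>

definition ipow :: "int \<Rightarrow> laurent" where
  "ipow n = Poly_Mapping.single (- n) (alt n)"

lemma alt_add: "alt (m + n) = alt m * alt n"
  by (auto simp: alt_def)

lemma alt_zero [simp]: "alt 0 = 1"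
  by (simp add: alt_def)

lemma alt_minus [simp]: "alt (- n) = alt n"
  by (simp add: alt_def)

lemma ipow_add: "ipow (m + n) = ipow m * ipow n"
  by (simp add: ipow_def alt_add Poly_Mapping.mult_single)

lemma ipow_zero [simp]: "ipow 0 = 1"
  by (simp add: ipow_def)

lemma ipow_cancel [simp]: "ipow n * ipow (- n) = 1" "ipow (- n) * ipow n = 1"
  "ipow n * (ipow (- n) * r) = r" "ipow (- n) * (ipow n * r) = r"
  by (simp_all flip: ipow_add mult.assoc)

lemma ipow_eq: "ipow n = of_int (alt n) * tpow (- n)"
  unfolding ipow_def by (rule single_eq_of_int_mult)

lemma ipow_even: "even n \<Longrightarrow> ipow n = tpow (- n)"
  by (simp add: ipow_def alt_def)

text \<open>The powers of t cancel in the product and only the sign remains. Associativity of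
  \<open>hall_mult\<close> rests on this equivariance.\<close>

lemma pairing_tpow_ipow: "pairing p (tpow n * a * (ipow n * b)) = alt n * pairing p (a * b)"
proof -
  have "tpow n * a * (ipow n * b) = of_int (alt n) * ((tpow n * tpow (- n)) * (a * b))"
    by (simp only: ipow_eq ac_simps)
  then show ?thesis
    by (simp only: tpow_cancel mult_1_left pairing_of_int_mult)
qed

type_synonym hall_tuple = "int \<times> laurent \<times> (nat \<Rightarrow> laurent) \<times> (nat \<Rightarrow> int)"

fun hall_mult :: "hall_tuple \<Rightarrow> hall_tuple \<Rightarrow> hall_tuple" where
  "hall_mult (n, a, b, c) (n', a', b', c') =
     (n + n', a + tpow n * a', \<lambda>l. b l + ipow n * b' l,
      \<lambda>l. (c l + alt n * c' l + pairing gap_seq (a * (ipow n * b' l))) mod nth_prime l)"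

text \<open>
  In \<open>(n, a, b, c)\<close> the component \<open>n\<close> is the exponent of \<open>t\<close>, which acts by \<open>t\<close> on \<open>a\<close>, by \<open>- t\<^sup>-\<^sup>1\<close>
  on \<open>b\<close> and by \<open>- 1\<close> on \<open>c\<close>. Having one \<open>b l\<close> for every prime makes room for all
  twists, and \<open>c l\<close> is the reduced residue modulo \<open>nth_prime l\<close>.
\<close>

definition ambient :: "hall_tuple monoid" where
  "ambient =
     \<lparr>carrier = {(n, a, b, c). \<forall>l. c l mod nth_prime l = c l},
      monoid.mult = hall_mult, one = (0, 0, \<lambda>_. 0, \<lambda>_. 0)\<rparr>"

lemma carrier_ambient [simp]: "(n, a, b, c) \<in> carrier ambient \<longleftrightarrow> (\<forall>l. c l mod nth_prime l = c l)"
  by (simp add: ambient_def)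

lemma mult_ambient [simp]: "x \<otimes>\<^bsub>ambient\<^esub> y = hall_mult x y"
  by (simp add: ambient_def)

lemma one_ambient [simp]: "\<one>\<^bsub>ambient\<^esub> = (0, 0, \<lambda>_. 0, \<lambda>_. 0)"
  by (simp add: ambient_def)

lemma mod_sum_nested:
  fixes q :: int
  shows "(x mod q + y + z) mod q = (x + y + z) mod q"
    and "(x + s * (y mod q) + z) mod q = (x + s * y + z) mod q"
  by (intro mod_add_cong mod_mult_cong; simp)+

lemma hall_mult_assoc: "hall_mult (hall_mult x y) z = hall_mult x (hall_mult y z)"
proof -
  obtain n a b c n' a' b' c' n'' a'' b'' c'' where xyz: "x = (n, a, b, c)" "y = (n', a', b', c')" "z = (n'', a'', b'', c'')"
    by (metis prod_cases4)
  have "((c l + alt n * c' l + pairing gap_seq (a * (ipow n * b' l))) mod nth_prime l + alt (n + n') * c'' l +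
        pairing gap_seq ((a + tpow n * a') * (ipow (n + n') * b'' l))) mod nth_prime l =
      (c l + alt n * ((c' l + alt n' * c'' l + pairing gap_seq (a' * (ipow n' * b'' l))) mod nth_prime l) +
        pairing gap_seq (a * (ipow n * (b' l + ipow n' * b'' l)))) mod nth_prime l" for l
  proof -
    have "pairing gap_seq ((a + tpow n * a') * (ipow (n + n') * b'' l)) =
        pairing gap_seq (a * (ipow n * (ipow n' * b'' l))) + alt n * pairing gap_seq (a' * (ipow n' * b'' l))"
      by (simp add: distrib_right pairing_add ipow_add mult.assoc flip: pairing_tpow_ipow)
    moreover have "pairing gap_seq (a * (ipow n * (b' l + ipow n' * b'' l))) =
        pairing gap_seq (a * (ipow n * b' l)) + pairing gap_seq (a * (ipow n * (ipow n' * b'' l)))"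
      by (simp add: distrib_left pairing_add)
    ultimately show ?thesis
      by (simp only: mod_sum_nested) (simp add: alt_add algebra_simps)
  qed
  then show ?thesis
    by (simp add: xyz tpow_add ipow_add distrib_left mult.assoc add.assoc)
qed

lemma group_ambient: "group ambient"
proof (rule groupI)
  fix x y assume "x \<in> carrier ambient" "y \<in> carrier ambient"
  then show "x \<otimes>\<^bsub>ambient\<^esub> y \<in> carrier ambient"
    by (cases x; cases y) auto
next
  fix x assume x: "x \<in> carrier ambient"
  obtain n a b c where [simp]: "x = (n, a, b, c)"
    by (metis prod_cases4)
  show "\<one>\<^bsub>ambient\<^esub> \<otimes>\<^bsub>ambient\<^esub> x = x"
    using x by simp
  \<comment> \<open>A left inverse, solved for one coordinate after the other; the last one absorbs
    the cocycle term.\<close>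
  define a' where "a' = - (tpow (- n) * a)"
  define b' where "b' = (\<lambda>l. - (ipow (- n) * b l))"
  define c' where "c' = (\<lambda>l. (- (alt n * c l) - pairing gap_seq (a' * (ipow (- n) * b l))) mod nth_prime l)"
  have "(c' l + alt n * c l + pairing gap_seq (a' * (ipow (- n) * b l))) mod nth_prime l = 0" for l
    unfolding c'_def mod_sum_nested by simp
  then have "hall_mult (- n, a', b', c') x = \<one>\<^bsub>ambient\<^esub>"
    by (simp add: a'_def b'_def)
  moreover have "(- n, a', b', c') \<in> carrier ambient"
    by (simp add: c'_def)
  ultimately show "\<exists>y\<in>carrier ambient. y \<otimes>\<^bsub>ambient\<^esub> x = \<one>\<^bsub>ambient\<^esub>"
    by (metis mult_ambient)
qed (auto simp: hall_mult_assoc)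

section \<open>Congruence levels: a chain of normal subgroups of finite index\<close>

definition level_period :: "nat \<Rightarrow> int" where
  "level_period X = 4 * radius X"

text \<open>Each \<open>b l\<close> is tested only modulo a power of its own prime, so shifts that
  differ from prime to prime can be imitated by a single polynomial. The exponent \<open>X\<close>
  lets the moduli absorb any given integer for large \<open>X\<close>.\<close>

fun level_cong :: "nat \<Rightarrow> hall_tuple \<Rightarrow> hall_tuple \<Rightarrow> bool" where
  "level_cong X (n, a, b, c) (n', a', b', c') \<longleftrightarrow>
     level_period X dvd n - n' \<and> a - a' \<in> cong_ideal (primorial X ^ X) (level_period X) \<and>
     (\<forall>l<X. b l - b' l \<in> cong_ideal (nth_prime l ^ X) (level_period X) \<and> c l = c' l)"

definition level :: "nat \<Rightarrow> hall_tuple set" where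
  "level X = {g \<in> carrier ambient. level_cong X g \<one>\<^bsub>ambient\<^esub>}"

lemma level_cong_sym: "level_cong X g h \<Longrightarrow> level_cong X h g"
proof -
  assume gh: "level_cong X g h"
  obtain n a b c n' a' b' c' where g: "g = (n, a, b, c)" and h: "h = (n', a', b', c')"
    by (metis prod_cases4)
  have "- (a - a') \<in> cong_ideal (primorial X ^ X) (level_period X)"
    using gh by (intro cong_ideal_minus) (simp add: g h)
  moreover have "- (b l - b' l) \<in> cong_ideal (nth_prime l ^ X) (level_period X)" if "l < X" for l
    using gh that by (intro cong_ideal_minus) (simp add: g h)
  ultimately show ?thesis
    using gh by (simp add: g h dvd_diff_commute)
qed

lemma level_cong_trans:
  assumes "level_cong X g h" "level_cong X h k" shows "level_cong X g k"
proof -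
  obtain n a b c n' a' b' c' n'' a'' b'' c''
    where ghk: "g = (n, a, b, c)" "h = (n', a', b', c')" "k = (n'', a'', b'', c'')"
    by (metis prod_cases4)
  have "level_period X dvd (n - n') + (n' - n'')"
    using assms by (intro dvd_add) (auto simp: ghk)
  moreover have "(a - a') + (a' - a'') \<in> cong_ideal (primorial X ^ X) (level_period X)"
    using assms by (intro cong_ideal_add) (auto simp: ghk)
  moreover have "(b l - b' l) + (b' l - b'' l) \<in> cong_ideal (nth_prime l ^ X) (level_period X)" if "l < X" for l
    using assms that by (intro cong_ideal_add) (auto simp: ghk)
  ultimately show ?thesis
    using assms by (simp add: ghk)
qed

lemma level_period_pos: "level_period X > 0"
  by (simp add: level_period_def radius_pos)

lemma even_level_period: "level_period X dvd n \<Longrightarrow> even n"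
  by (auto simp: level_period_def elim: dvdE)

lemma level_period_alt: "level_period X dvd n \<Longrightarrow> alt n = 1"
  using even_level_period by (simp add: alt_def)

lemma level_period_ipow: "level_period X dvd n \<Longrightarrow> ipow n - 1 \<in> cong_ideal d (level_period X)"
  using tpow_minus_1_in_cong_ideal[of "level_period X" "- n" d] by (simp add: even_level_period ipow_even)

lemma cong_ideal_ipow: "b \<in> cong_ideal d m \<Longrightarrow> ipow n * b \<in> cong_ideal d m"
  by (rule cong_ideal_mult)

text \<open>Either modulus is divisible by \<open>nth_prime l\<close>, and
  \<open>level_period X\<close> is a period of the sequence modulo this prime. So a factor from the
  level removes the cocycle term from the first \<open>X\<close> coordinates of c.\<close>

lemma pairing_level:
  assumes "r \<in> cong_ideal (primorial X ^ X) (level_period X) \<or> r \<in> cong_ideal (nth_prime l ^ X) (level_period X)" "l < X"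
  shows "nth_prime l dvd pairing gap_seq r"
proof -
  have per: "[gap_seq (level_period X + k) = gap_seq k] (mod nth_prime l)" for k
    using assms(2) by (intro gap_seq_periodic[of l X]) (simp_all add: level_period_def)
  have "nth_prime l dvd nth_prime l ^ X" "nth_prime l dvd primorial X ^ X"
    using assms(2) nth_prime_dvd_primorial[of l X] by (auto intro: dvd_power dvd_trans)
  then show ?thesis
    using assms(1) pairing_cong_ideal[where p = gap_seq, OF _ _ per] by blast
qed

text \<open>This and the next two lemmas show that the congruence classes are the right cosets of
  \<open>level X\<close> and contain the left ones. The subgroup laws and normality then follow
  without computing an inverse or a conjugate in coordinates.\<close>

lemma level_cong_mult_left:
  assumes "k \<in> level X" "h \<in> carrier ambient"
  shows "level_cong X (k \<otimes>\<^bsub>ambient\<^esub> h) h"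
proof -
  obtain d a b c n' a' b' c' where k: "k = (d, a, b, c)" and h: "h = (n', a', b', c')"
    by (metis prod_cases4)
  have d: "level_period X dvd d" and a: "a \<in> cong_ideal (primorial X ^ X) (level_period X)"
    and bc: "\<And>l. l < X \<Longrightarrow> b l \<in> cong_ideal (nth_prime l ^ X) (level_period X)" "\<And>l. l < X \<Longrightarrow> c l = 0"
    using assms(1) by (auto simp: level_def k)
  have "a + (tpow d - 1) * a' \<in> cong_ideal (primorial X ^ X) (level_period X)"
    using cong_ideal_mult[OF tpow_minus_1_in_cong_ideal[OF d]] a by (auto simp: mult.commute intro: cong_ideal_add)
  moreover have "b l + (ipow d - 1) * b' l \<in> cong_ideal (nth_prime l ^ X) (level_period X)" if "l < X" for l
    using cong_ideal_mult[OF level_period_ipow[OF d]] bc[OF that] by (auto simp: mult.commute intro: cong_ideal_add)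
  moreover have "(c l + alt d * c' l + pairing gap_seq (a * (ipow d * b' l))) mod nth_prime l = c' l" if l: "l < X" for l
  proof -
    have "a * (ipow d * b' l) \<in> cong_ideal (primorial X ^ X) (level_period X)"
      using cong_ideal_mult[OF a, of "ipow d * b' l"] by (simp add: mult.commute)
    then have "nth_prime l dvd pairing gap_seq (a * (ipow d * b' l))"
      using pairing_level l by blast
    then show ?thesis
      using assms(2) bc[OF l] d by (auto simp: h level_period_alt mod_add_right_eq[symmetric])
  qed
  ultimately show ?thesis
    using d by (simp add: k h algebra_simps)
qed

lemma level_cong_mult_right:
  assumes "k \<in> level X" "h \<in> carrier ambient"
  shows "level_cong X (h \<otimes>\<^bsub>ambient\<^esub> k) h"
proof -
  obtain d a b c n' a' b' c' where k: "k = (d, a, b, c)" and h: "h = (n', a', b', c')"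
    by (metis prod_cases4)
  have d: "level_period X dvd d" and a: "a \<in> cong_ideal (primorial X ^ X) (level_period X)"
    and bc: "\<And>l. l < X \<Longrightarrow> b l \<in> cong_ideal (nth_prime l ^ X) (level_period X)" "\<And>l. l < X \<Longrightarrow> c l = 0"
    using assms(1) by (auto simp: level_def k)
  have "(c' l + alt n' * c l + pairing gap_seq (a' * (ipow n' * b l))) mod nth_prime l = c' l" if l: "l < X" for l
  proof -
    have "a' * (ipow n' * b l) \<in> cong_ideal (nth_prime l ^ X) (level_period X)"
      by (intro cong_ideal_mult bc l)
    then have "nth_prime l dvd pairing gap_seq (a' * (ipow n' * b l))"
      using pairing_level l by blast
    then show ?thesis
      using assms(2) bc[OF l] by (auto simp: h mod_add_right_eq[symmetric])
  qed
  then show ?thesis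
    using d a bc by (simp add: k h cong_ideal_ipow)
qed

lemma level_cong_factor:
  assumes "level_cong X g h" "g \<in> carrier ambient" "h \<in> carrier ambient"
  obtains k where "k \<in> level X" "g = k \<otimes>\<^bsub>ambient\<^esub> h"
proof -
  obtain n a b c n' a' b' c' where g: "g = (n, a, b, c)" and h: "h = (n', a', b', c')"
    by (metis prod_cases4)
  define d where "d = n - n'"
  define a'' where "a'' = a - tpow d * a'"
  define b'' where "b'' = (\<lambda>l. b l - ipow d * b' l)"
  define c'' where "c'' = (\<lambda>l. (c l - alt d * c' l - pairing gap_seq (a'' * (ipow d * b' l))) mod nth_prime l)"
  have d: "level_period X dvd d" and a: "a - a' \<in> cong_ideal (primorial X ^ X) (level_period X)"
    and bc: "\<And>l. l < X \<Longrightarrow> b l - b' l \<in> cong_ideal (nth_prime l ^ X) (level_period X)" "\<And>l. l < X \<Longrightarrow> c l = c' l"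
    using assms(1) by (auto simp: g h d_def)
  have "(a - a') - a' * (tpow d - 1) \<in> cong_ideal (primorial X ^ X) (level_period X)"
    by (intro cong_ideal_diff a cong_ideal_mult tpow_minus_1_in_cong_ideal d)
  then have a'': "a'' \<in> cong_ideal (primorial X ^ X) (level_period X)"
    by (simp add: a''_def algebra_simps)
  have "(b l - b' l) - b' l * (ipow d - 1) \<in> cong_ideal (nth_prime l ^ X) (level_period X)" if "l < X" for l
    by (intro cong_ideal_diff bc that cong_ideal_mult level_period_ipow d)
  then have b'': "b'' l \<in> cong_ideal (nth_prime l ^ X) (level_period X)" if "l < X" for l
    using that by (simp add: b''_def algebra_simps)
  have c'': "c'' l = 0" if "l < X" for l
  proof -
    have "a'' * (ipow d * b' l) \<in> cong_ideal (primorial X ^ X) (level_period X)"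
      using cong_ideal_mult[OF a'', of "ipow d * b' l"] by (simp add: mult.commute)
    then have "nth_prime l dvd pairing gap_seq (a'' * (ipow d * b' l))"
      using pairing_level that by blast
    then show ?thesis
      using bc(2)[OF that] by (simp add: c''_def level_period_alt[OF d] mod_eq_0_iff_dvd)
  qed
  have "(d, a'', b'', c'') \<in> level X"
    using d a'' b'' c'' by (simp add: level_def) (simp add: c''_def)
  moreover have "(c'' l + alt d * c' l + pairing gap_seq (a'' * (ipow d * b' l))) mod nth_prime l = c l" for l
    using assms(2) unfolding c''_def mod_sum_nested by (simp add: g)
  then have "g = (d, a'', b'', c'') \<otimes>\<^bsub>ambient\<^esub> h"
    by (simp add: g h d_def a''_def b''_def)
  ultimately show ?thesis
    by (rule that)
qed

lemma level_rcoset: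
  assumes "h \<in> carrier ambient"
  shows "level X #>\<^bsub>ambient\<^esub> h = {g \<in> carrier ambient. level_cong X g h}"
proof (intro equalityI subsetI)
  interpret group ambient by (rule group_ambient)
  fix g assume "g \<in> level X #>\<^bsub>ambient\<^esub> h"
  then obtain k where "k \<in> level X" "g = k \<otimes>\<^bsub>ambient\<^esub> h"
    by (auto simp: r_coset_def)
  then show "g \<in> {g \<in> carrier ambient. level_cong X g h}"
    using level_cong_mult_left[OF _ assms] m_closed[of k h] assms by (auto simp: level_def simp del: mult_ambient)
next
  fix g assume "g \<in> {g \<in> carrier ambient. level_cong X g h}"
  then show "g \<in> level X #>\<^bsub>ambient\<^esub> h"
    using level_cong_factor[of X g h] assms by (auto simp: r_coset_def simp del: mult_ambient)
qed

lemma one_in_level: "\<one>\<^bsub>ambient\<^esub> \<in> level X"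
  by (simp add: level_def)

lemma level_normal: "level X \<lhd> ambient"
proof -
  interpret group ambient by (rule group_ambient)
  have sub: "subgroup (level X) ambient"
  proof (unfold_locales)
    show "level X \<subseteq> carrier ambient"
      by (auto simp: level_def)
    show "\<one>\<^bsub>ambient\<^esub> \<in> level X"
      by (rule one_in_level)
  next
    fix k k' assume k: "k \<in> level X" "k' \<in> level X"
    then have "level_cong X (k \<otimes>\<^bsub>ambient\<^esub> k') \<one>\<^bsub>ambient\<^esub>"
      using level_cong_trans level_cong_mult_left unfolding level_def by blast
    then show "k \<otimes>\<^bsub>ambient\<^esub> k' \<in> level X"
      using k m_closed by (simp add: level_def del: mult_ambient one_ambient)
  next
    fix k assume k: "k \<in> level X"
    then have kc: "k \<in> carrier ambient"
      by (simp add: level_def)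
    then have "level_cong X (inv\<^bsub>ambient\<^esub> k \<otimes>\<^bsub>ambient\<^esub> k) (inv\<^bsub>ambient\<^esub> k)"
      using level_cong_mult_right[OF k] by blast
    then have "level_cong X (inv\<^bsub>ambient\<^esub> k) \<one>\<^bsub>ambient\<^esub>"
      using level_cong_sym l_inv[OF kc] by metis
    then show "inv\<^bsub>ambient\<^esub> k \<in> level X"
      using kc by (simp add: level_def del: one_ambient)
  qed
  have "h \<otimes>\<^bsub>ambient\<^esub> k \<otimes>\<^bsub>ambient\<^esub> inv\<^bsub>ambient\<^esub> h \<in> level X"
    if k: "k \<in> level X" and h: "h \<in> carrier ambient" for h k
  proof -
    have kc: "k \<in> carrier ambient"
      using k by (simp add: level_def)
    obtain k' where k': "k' \<in> level X" "h \<otimes>\<^bsub>ambient\<^esub> k = k' \<otimes>\<^bsub>ambient\<^esub> h"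
      using level_cong_factor[OF level_cong_mult_right[OF k h] m_closed[OF h kc] h] by blast
    then have "k' \<in> carrier ambient"
      by (simp add: level_def)
    then show ?thesis
      using k' h kc by (simp add: m_assoc del: mult_ambient one_ambient)
  qed
  then show ?thesis
    using sub by (auto simp: normal_inv_iff simp del: mult_ambient one_ambient)
qed

lemma level_finite_index: "finite (carrier (ambient Mod level X))"
proof -
  have "\<exists>\<rho> F. finite F \<and> range \<rho> \<subseteq> F \<and> (\<forall>r. r - \<rho> r \<in> cong_ideal d (level_period X))" if d: "d > 0" for d
  proof (rule cong_ideal_finite_index[OF d level_period_pos[of X]])
    fix F assume F: "finite F" "\<And>r. \<exists>f\<in>F. r - f \<in> cong_ideal d (level_period X)"
    then obtain \<rho> where "\<And>r. \<rho> r \<in> F \<and> r - \<rho> r \<in> cong_ideal d (level_period X)"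
      by metis
    then show ?thesis
      using F(1) by blast
  qed
  then obtain \<rho> F where \<rho>: "\<And>d. d > 0 \<Longrightarrow> finite (F d)" "\<And>d r. d > 0 \<Longrightarrow> \<rho> d r \<in> F d"
    "\<And>d r. d > 0 \<Longrightarrow> r - \<rho> d r \<in> cong_ideal d (level_period X)"
    by (metis range_subsetD)
  have eq: "r - s \<in> cong_ideal d (level_period X)" if "d > 0" "\<rho> d r = \<rho> d s" for d r s
    using cong_ideal_diff[OF \<rho>(3)[OF that(1), of r] \<rho>(3)[OF that(1), of s]] that(2) by simp
  have pos: "primorial X ^ X > 0" "nth_prime l ^ X > 0" for l
    using primorial_pos prime_gt_0_int[OF prime_nth_prime] by auto
  \<comment> \<open>\<open>\<kappa>\<close> collects the residues that define the congruence. It has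
    finitely many values, and equal values put two elements into one coset.\<close>
  define \<kappa> where "\<kappa> = (\<lambda>(n, a, b, c). (n mod level_period X, \<rho> (primorial X ^ X) a,
    \<lambda>l\<in>{..<X}. \<rho> (nth_prime l ^ X) (b l), \<lambda>l\<in>{..<X}. c l :: int))"
  define Y where "Y = {0..<level_period X} \<times> F (primorial X ^ X) \<times>
    (\<Pi>\<^sub>E l\<in>{..<X}. F (nth_prime l ^ X)) \<times> (\<Pi>\<^sub>E l\<in>{..<X}. {0..<nth_prime l})"
  have "finite Y"
    unfolding Y_def using \<rho>(1) pos by (intro finite_cartesian_product finite_PiE) auto
  have "\<kappa> g \<in> Y" if g: "g \<in> carrier ambient" for g
  proof -
    obtain n a b c where gg: "g = (n, a, b, c)" by (metis prod_cases4)
    have "c l = c l mod nth_prime l" for l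
      using g by (simp add: gg)
    then have "0 \<le> c l \<and> c l < nth_prime l" for l
      using prime_gt_0_int[OF prime_nth_prime, of l] pos_mod_sign pos_mod_bound by metis
    then show ?thesis
      using \<rho>(2) pos level_period_pos by (auto simp: gg \<kappa>_def Y_def)
  qed
  then have fin: "finite (\<kappa> ` carrier ambient)"
    using \<open>finite Y\<close> by (meson finite_subset image_subsetI)
  have cong: "level_cong X g h" if "\<kappa> g = \<kappa> h" for g h
  proof -
    obtain n a b c n' a' b' c' where g: "g = (n, a, b, c)" and h: "h = (n', a', b', c')"
      by (metis prod_cases4)
    have k: "n mod level_period X = n' mod level_period X" "\<rho> (primorial X ^ X) a = \<rho> (primorial X ^ X) a'"
      "(\<lambda>l\<in>{..<X}. \<rho> (nth_prime l ^ X) (b l)) = (\<lambda>l\<in>{..<X}. \<rho> (nth_prime l ^ X) (b' l))"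
      "(\<lambda>l\<in>{..<X}. c l) = (\<lambda>l\<in>{..<X}. c' l)"
      using that by (simp_all add: g h \<kappa>_def)
    have "\<rho> (nth_prime l ^ X) (b l) = \<rho> (nth_prime l ^ X) (b' l)" "c l = c' l" if "l < X" for l
      using fun_cong[OF k(3), of l] fun_cong[OF k(4), of l] that by simp_all
    then show ?thesis
      using k(1,2) eq pos by (auto simp: g h mod_eq_dvd_iff)
  qed
  have "rcosets\<^bsub>ambient\<^esub> level X \<subseteq> (\<lambda>z. level X #>\<^bsub>ambient\<^esub> inv_into (carrier ambient) \<kappa> z) ` \<kappa> ` carrier ambient"
  proof
    fix C assume "C \<in> rcosets\<^bsub>ambient\<^esub> level X"
    then obtain g where g: "g \<in> carrier ambient" "C = level X #>\<^bsub>ambient\<^esub> g"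
      by (auto simp: RCOSETS_def)
    define h where "h = inv_into (carrier ambient) \<kappa> (\<kappa> g)"
    have h: "h \<in> carrier ambient" "\<kappa> h = \<kappa> g"
      using g(1) unfolding h_def by (auto intro: inv_into_into f_inv_into_f)
    then have "level X #>\<^bsub>ambient\<^esub> g = level X #>\<^bsub>ambient\<^esub> h"
      using cong[of g h] cong[of h g] g(1) level_cong_trans
      unfolding level_rcoset[OF g(1)] level_rcoset[OF h(1)] by metis
    then show "C \<in> (\<lambda>z. level X #>\<^bsub>ambient\<^esub> inv_into (carrier ambient) \<kappa> z) ` \<kappa> ` carrier ambient"
      using g h_def by blast
  qed
  then show ?thesis
    using fin by (auto simp: FactGroup_def intro: finite_subset)
qed

lemma level_antimono:
  assumes "X \<le> Y" shows "level Y \<subseteq> level X"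
proof
  fix g assume g: "g \<in> level Y"
  obtain n a b c where gg: "g = (n, a, b, c)" by (metis prod_cases4)
  have per: "level_period X dvd level_period Y"
    using radius_dvd[OF assms] by (simp add: level_period_def)
  have "primorial X dvd primorial Y"
    using assms by (auto simp: primorial_dvd_iff nth_prime_dvd_primorial)
  then have pow: "primorial X ^ X dvd primorial Y ^ Y"
    using assms by (rule dvd_power_le)
  have a: "a \<in> cong_ideal (primorial X ^ X) (level_period X)"
    using g cong_ideal_mono[OF pow per] by (auto simp: gg level_def)
  have b: "b l \<in> cong_ideal (nth_prime l ^ X) (level_period X)" if "l < X" for l
    using g that assms subsetD[OF cong_ideal_mono[OF le_imp_power_dvd[OF assms] per]] by (simp add: gg level_def)
  have "level_period X dvd n"
    using g per by (auto simp: gg level_def intro: dvd_trans)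
  then show "g \<in> level X"
    using g a b assms by (simp add: gg level_def)
qed

section \<open>The twisted groups\<close>

text \<open>These are the c coordinates of a commutator of \<open>a\<close> and \<open>b\<close>
  with product \<open>r\<close>, after the shift by \<open>j l\<close> at the prime
  \<open>nth_prime l\<close>.\<close>

definition twist :: "(nat \<Rightarrow> int) \<Rightarrow> laurent \<Rightarrow> nat \<Rightarrow> int" where
  "twist j r = (\<lambda>l. pairing gap_seq (tpow (j l) * r) mod nth_prime l)"

text \<open>\<open>r\<close> only represents the c coordinate: Laurent polynomials with the same
  twist give the same element. In these parameters the multiplication formula does not involve
  \<open>j\<close>, so all twists can be treated together.\<close>

definition hall_elem :: "(nat \<Rightarrow> int) \<Rightarrow> int \<Rightarrow> laurent \<Rightarrow> laurent \<Rightarrow> laurent \<Rightarrow> hall_tuple" where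
  "hall_elem j n a b r = (n, a, \<lambda>l. tpow (j l) * b, twist j r)"

definition hall_set :: "(nat \<Rightarrow> int) \<Rightarrow> hall_tuple set" where
  "hall_set j = {hall_elem j n a b r | n a b r. True}"

definition hall_group :: "(nat \<Rightarrow> int) \<Rightarrow> hall_tuple monoid" where
  "hall_group j = ambient\<lparr>carrier := hall_set j\<rparr>"

lemma hall_elem_in [simp]: "hall_elem j n a b r \<in> hall_set j"
  by (auto simp: hall_set_def)

lemma hall_elem_cases:
  assumes "x \<in> hall_set j"
  obtains n a b r where "x = hall_elem j n a b r"
  using assms by (auto simp: hall_set_def)

lemma hall_set_ambient: "hall_set j \<subseteq> carrier ambient"
  by (auto simp: hall_set_def hall_elem_def twist_def)

lemma twist_zero [simp]: "twist j 0 = (\<lambda>_. 0)"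
  by (simp add: twist_def)

lemma hall_elem_mult:
  "hall_mult (hall_elem j n a b r) (hall_elem j n' a' b' r') =
     hall_elem j (n + n') (a + tpow n * a') (b + ipow n * b') (r + of_int (alt n) * r' + a * (ipow n * b'))"
proof -
  have "(pairing gap_seq (tpow (j l) * r) mod nth_prime l +
        alt n * (pairing gap_seq (tpow (j l) * r') mod nth_prime l) +
        pairing gap_seq (a * (ipow n * (tpow (j l) * b')))) mod nth_prime l =
      pairing gap_seq (tpow (j l) * (r + of_int (alt n) * r' + a * (ipow n * b'))) mod nth_prime l" for l
  proof -
    have "tpow (j l) * (r + of_int (alt n) * r' + a * (ipow n * b')) =
        tpow (j l) * r + of_int (alt n) * (tpow (j l) * r') + a * (ipow n * (tpow (j l) * b'))"
      by (simp only: distrib_left ac_simps)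
    then show ?thesis
      by (simp only: mod_sum_nested pairing_add pairing_of_int_mult)
  qed
  moreover have "tpow (j l) * b + ipow n * (tpow (j l) * b') = tpow (j l) * (b + ipow n * b')" for l
    by (simp only: distrib_left ac_simps)
  ultimately show ?thesis
    by (simp add: hall_elem_def twist_def)
qed

lemma hall_elem_one: "hall_elem j 0 0 0 0 = \<one>\<^bsub>ambient\<^esub>"
  by (simp add: hall_elem_def)

lemma hall_elem_inverse:
  obtains r' where "hall_mult (hall_elem j (- n) (- (tpow (- n) * a)) (- (ipow (- n) * b)) r') (hall_elem j n a b r) = \<one>\<^bsub>ambient\<^esub>"
proof
  show "hall_mult (hall_elem j (- n) (- (tpow (- n) * a)) (- (ipow (- n) * b))
      (- (of_int (alt n) * r) + tpow (- n) * a * (ipow (- n) * b))) (hall_elem j n a b r) = \<one>\<^bsub>ambient\<^esub>"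
    unfolding hall_elem_mult hall_elem_one[of j, symmetric] by simp
qed

lemma subgroup_hall_set: "subgroup (hall_set j) ambient"
proof -
  interpret group ambient by (rule group_ambient)
  show ?thesis
  proof (unfold_locales)
    fix x assume x: "x \<in> hall_set j"
    then obtain n a b r where x': "x = hall_elem j n a b r"
      by (auto simp: hall_set_def)
    obtain r' where "hall_mult (hall_elem j (- n) (- (tpow (- n) * a)) (- (ipow (- n) * b)) r') x = \<one>\<^bsub>ambient\<^esub>"
      unfolding x' by (rule hall_elem_inverse)
    then have "inv\<^bsub>ambient\<^esub> x = hall_elem j (- n) (- (tpow (- n) * a)) (- (ipow (- n) * b)) r'"
      using hall_set_ambient[of j] x by (intro inv_equality) (auto simp del: one_ambient)
    then show "inv\<^bsub>ambient\<^esub> x \<in> hall_set j"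
      by simp
  next
    fix x y assume "x \<in> hall_set j" "y \<in> hall_set j"
    then show "x \<otimes>\<^bsub>ambient\<^esub> y \<in> hall_set j"
      by (auto elim!: hall_elem_cases simp: hall_elem_mult)
  next
    show "\<one>\<^bsub>ambient\<^esub> \<in> hall_set j"
      using hall_elem_in[of j 0 0 0 0] by (simp only: hall_elem_one)
  qed (rule hall_set_ambient)
qed

lemma group_hall_group: "group (hall_group j)"
  unfolding hall_group_def
  using group.subgroup_imp_group[OF group_ambient subgroup_hall_set] .

lemma carrier_hall_group [simp]: "carrier (hall_group j) = hall_set j"
  by (simp add: hall_group_def)

lemma mult_hall_group [simp]: "x \<otimes>\<^bsub>hall_group j\<^esub> y = hall_mult x y"
  by (simp add: hall_group_def)

lemma one_hall_group: "\<one>\<^bsub>hall_group j\<^esub> = hall_elem j 0 0 0 0"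
  by (simp add: hall_group_def hall_elem_one del: one_ambient)

text \<open>With \<open>b\<close> placed to the left of \<open>a\<close> no cocycle term arises, so
  the coordinates can be handled one by one.\<close>

lemma hall_elem_factor:
  "hall_elem j n a b r = hall_mult (hall_elem j 0 0 0 r) (hall_mult (hall_elem j 0 0 b 0)
     (hall_mult (hall_elem j 0 a 0 0) (hall_elem j n 0 0 0)))"
  by (simp add: hall_elem_mult)

text \<open>Integers \<open>e l\<close> that are 1 modulo their own prime power and 0 modulo the
  others glue the targets, each shifted back by its own power of t. This is why finitely many primes
  never notice the twist.\<close>

lemma crt_laurent:
  fixes f :: "nat \<Rightarrow> laurent"
  obtains s where "\<And>l. l < X \<Longrightarrow> \<exists>u. f l - tpow (j l) * s = of_int (nth_prime l ^ E) * u"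
proof -
  have "\<exists>e. [e = 1] (mod nth_prime l ^ E) \<and> [e = 0] (mod (\<Prod>i\<in>{..<X} - {l}. nth_prime i ^ E))" for l
    by (rule binary_chinese_remainder_int) (auto intro!: prod_coprime_right coprime_nth_prime)
  then obtain e where e: "\<And>l. [e l = 1] (mod nth_prime l ^ E)"
    "\<And>l. [e l = 0] (mod (\<Prod>i\<in>{..<X} - {l}. nth_prime i ^ E))"
    by metis
  define s where "s = (\<Sum>i<X. of_int (e i) * (tpow (- j i) * f i))"
  show ?thesis
  proof (rule that[of s])
    fix l assume l: "l < X"
    have div: "nth_prime l ^ E dvd e i" if "i < X" "i \<noteq> l" for i
    proof -
      have "nth_prime l ^ E dvd (\<Prod>i\<in>{..<X} - {i}. nth_prime i ^ E)"
        using that l by (intro dvd_prodI) auto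
      then show ?thesis
        using e(2)[of i] by (auto simp: cong_0_iff intro: dvd_trans)
    qed
    \<comment> \<open>\<open>g i\<close> is the residue wanted for \<open>e i\<close> at the prime
      \<open>nth_prime l\<close>, which is 1 or 0, minus \<open>e i\<close> itself; so it is
      divisible by the prime power.\<close>
    define g where "g i = (if i = l then 1 - e l else - e i)" for i
    have g: "nth_prime l ^ E dvd g i" if "i < X" for i
      using div[OF that] e(1)[of l] by (auto simp: g_def cong_iff_dvd_diff dvd_diff_commute)
    define h where "h i = (if i = l then f l else tpow (j l) * (tpow (- j i) * f i))" for i
    have "f l - tpow (j l) * s = (\<Sum>i<X. of_int (g i) * h i)"
    proof -
      have "tpow (j l) * s = (\<Sum>i<X. of_int (e i) * h i)"
        by (auto simp: s_def h_def sum_distrib_left mult.left_commute intro!: sum.cong)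
      moreover have "f l = (\<Sum>i<X. if i = l then f l else 0)"
        using l by simp
      ultimately have "f l - tpow (j l) * s = (\<Sum>i<X. (if i = l then f l else 0) - of_int (e i) * h i)"
        by (simp add: sum_subtractf)
      also have "\<dots> = (\<Sum>i<X. of_int (g i) * h i)"
        by (intro sum.cong) (auto simp: g_def h_def algebra_simps)
      finally show ?thesis .
    qed
    also have "\<dots> = (\<Sum>i<X. of_int (nth_prime l ^ E) * (of_int (g i div nth_prime l ^ E) * h i))"
    proof (intro sum.cong refl)
      fix i assume "i \<in> {..<X}"
      then have "g i = nth_prime l ^ E * (g i div nth_prime l ^ E)"
        using g by simp
      then show "of_int (g i) * h i = of_int (nth_prime l ^ E) * (of_int (g i div nth_prime l ^ E) * h i)"
        by (metis mult.assoc of_int_mult)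
    qed
    also have "\<dots> = of_int (nth_prime l ^ E) * (\<Sum>i<X. of_int (g i div nth_prime l ^ E) * h i)"
      by (rule sum_distrib_left[symmetric])
    finally show "\<exists>u. f l - tpow (j l) * s = of_int (nth_prime l ^ E) * u"
      by blast
  qed
qed

text \<open>Since this holds for every \<open>j\<close>, the untwisted and the twisted group have
  the same image modulo every level.\<close>

lemma hall_set_dense:
  assumes "g \<in> carrier ambient"
  shows "\<exists>h\<in>hall_set j. g \<in> level X #>\<^bsub>ambient\<^esub> h"
proof -
  obtain n a b c where g: "g = (n, a, b, c)" by (metis prod_cases4)
  obtain b0 where b0: "\<And>l. l < X \<Longrightarrow> \<exists>u. b l - tpow (j l) * b0 = of_int (nth_prime l ^ X) * u"
    using crt_laurent[of X b j X] by blast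
  \<comment> \<open>At the centre the sequence takes the value \<open>primorial l\<close>, a unit
    modulo \<open>nth_prime l\<close>, so a monomial placed there realises any prescribed
    residue.\<close>
  have "\<exists>z. [primorial l * z = c l] (mod nth_prime l)" for l
  proof -
    obtain w where "[primorial l * w = 1] (mod nth_prime l)"
      using cong_solve_coprime_int[OF coprime_primorial[of l]] by blast
    then have "[primorial l * w * c l = 1 * c l] (mod nth_prime l)"
      by (rule cong_mult) simp
    then show ?thesis
      by (metis mult.assoc mult_1)
  qed
  then obtain z where z: "\<And>l. [primorial l * z l = c l] (mod nth_prime l)"
    by metis
  obtain r where r: "\<And>l. l < X \<Longrightarrow> \<exists>u. Poly_Mapping.single (2 * radius l) (z l) - tpow (j l) * r = of_int (nth_prime l ^ 1) * u"
    using crt_laurent[of X "\<lambda>l. Poly_Mapping.single (2 * radius l) (z l)" j 1] by blast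
  have "b l - tpow (j l) * b0 \<in> cong_ideal (nth_prime l ^ X) (level_period X)" if "l < X" for l
    using b0[OF that] cong_ideal_of_int[OF dvd_refl] by metis
  moreover have "twist j r l = c l" if l: "l < X" for l
  proof -
    obtain u where u: "Poly_Mapping.single (2 * radius l) (z l) - tpow (j l) * r = of_int (nth_prime l) * u"
      using r[OF l] by auto
    have "pairing gap_seq (Poly_Mapping.single (2 * radius l) (z l)) - pairing gap_seq (tpow (j l) * r) = nth_prime l * pairing gap_seq u"
      by (metis pairing_diff pairing_of_int_mult u)
    then have "[pairing gap_seq (tpow (j l) * r) = z l * primorial l] (mod nth_prime l)"
      by (simp add: gap_seq_centre cong_iff_dvd_diff) (metis dvd_diff_commute dvd_triv_left)
    then have "[pairing gap_seq (tpow (j l) * r) = c l] (mod nth_prime l)"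
      using z[of l] by (simp add: mult.commute cong_trans)
    then show ?thesis
      using assms by (simp add: g twist_def cong_def)
  qed
  ultimately have "level_cong X g (hall_elem j n a b0 r)"
    by (simp add: g hall_elem_def)
  then show ?thesis
    using assms level_rcoset[of "hall_elem j n a b0 r"] hall_set_ambient[of j] hall_elem_in[of j n a b0 r] by blast
qed

section \<open>Residual finiteness: the levels separate elements\<close>

lemma nth_prime_ge_2: "nth_prime l \<ge> 2"
  using prime_ge_2_int by simp

lemma power_gt_nat: "2 \<le> (z::int) \<Longrightarrow> int X < z ^ X"
proof (induction X)
  case (Suc X)
  then have "2 * z ^ X \<le> z ^ Suc X"
    by simp
  then show ?case
    using Suc by linarith
qed simp

lemma level_modulus_unbounded:
  assumes "int X > B"
  shows "level_period X > B" "nth_prime l ^ X > B" "X > 0 \<Longrightarrow> primorial X ^ X > B"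
proof -
  show "level_period X > B"
    using assms radius_gt[of X] by (simp add: level_period_def)
  show "nth_prime l ^ X > B"
    using assms power_gt_nat[OF nth_prime_ge_2[of l], of X] by simp
  show "primorial X ^ X > B" if "X > 0"
  proof -
    have "nth_prime 0 dvd primorial X"
      using that by (rule nth_prime_dvd_primorial)
    then have "primorial X \<ge> 2"
      using zdvd_imp_le[OF _ primorial_pos] nth_prime_ge_2[of 0] by (meson order_trans)
    then show ?thesis
      using assms power_gt_nat[of "primorial X" X] by simp
  qed
qed

lemma level_separates:
  assumes "x \<in> hall_set j" "\<And>X. x \<in> level X"
  shows "x = \<one>\<^bsub>ambient\<^esub>"
proof -
  obtain n a b r where x: "x = hall_elem j n a b r"
    using assms(1) by (rule hall_elem_cases)
  have n: "level_period X dvd n" and a: "a \<in> cong_ideal (primorial X ^ X) (level_period X)"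
    and b: "\<And>l. l < X \<Longrightarrow> b \<in> cong_ideal (nth_prime l ^ X) (level_period X)"
    and c: "\<And>l. l < X \<Longrightarrow> twist j r l = 0" for X
    using assms(2)[of X] by (auto simp: x level_def hall_elem_def)
  have "n = 0"
  proof (rule ccontr)
    assume "n \<noteq> 0"
    then have "\<bar>level_period (nat \<bar>n\<bar>)\<bar> \<le> \<bar>n\<bar>"
      using n by (intro dvd_imp_le_int)
    then show False
      using radius_gt[of "nat \<bar>n\<bar>"] by (simp add: level_period_def)
  qed
  moreover have "a = 0"
  proof (rule ccontr)
    assume "a \<noteq> 0"
    then obtain B where B: "\<And>d m. d > B \<Longrightarrow> m > B \<Longrightarrow> a \<notin> cong_ideal d m"
      by (rule cong_ideal_separated) blast
    then show False
      using level_modulus_unbounded[of B "Suc (nat \<bar>B\<bar>)"] a[of "Suc (nat \<bar>B\<bar>)"] by auto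
  qed
  \<comment> \<open>All coordinates \<open>b l\<close> are shifts of one \<open>b\<close>, so powers
    of the single prime \<open>nth_prime 0\<close> are enough to separate it.\<close>
  moreover have "b = 0"
  proof (rule ccontr)
    assume "b \<noteq> 0"
    then obtain B where B: "\<And>d m. d > B \<Longrightarrow> m > B \<Longrightarrow> b \<notin> cong_ideal d m"
      by (rule cong_ideal_separated) blast
    then show False
      using level_modulus_unbounded[of B "Suc (nat \<bar>B\<bar>)"] b[of 0 "Suc (nat \<bar>B\<bar>)"] by auto
  qed
  moreover have "twist j r = (\<lambda>_. 0)"
    using c[of _ "Suc _"] by (intro ext) auto
  ultimately show ?thesis
    by (simp add: x hall_elem_def)
qed

section \<open>Cofinality of the levels among the normal subgroups of finite index\<close>

lemma cong_ideal_prod_coprime: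
  assumes "\<And>l. l < Y \<Longrightarrow> r \<in> cong_ideal (nth_prime l ^ E) m"
  shows "r \<in> cong_ideal (primorial Y ^ E) m"
  using assms
proof (induction Y)
  case 0
  show ?case
    by (rule cong_idealI[of _ _ r _ 0]) (simp add: primorial_def)
next
  case (Suc Y)
  have "coprime (primorial Y ^ E) (nth_prime Y ^ E)"
    using coprime_primorial by simp
  then have "r \<in> cong_ideal (primorial Y ^ E * nth_prime Y ^ E) m"
    using Suc by (intro cong_ideal_coprime) auto
  then show ?case
    by (simp add: primorial_Suc power_mult_distrib)
qed

text \<open>Induction splits off a prime, e = q * f; one further factor p pays for q, and f < e
  leaves room for it.\<close>

lemma dvd_power_of_prime_divisors:
  fixes e p :: nat
  assumes "e > 0" "\<And>q. prime q \<Longrightarrow> q dvd e \<Longrightarrow> q dvd p"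
  shows "e dvd p ^ e"
  using assms
proof (induction e rule: less_induct)
  case (less e)
  show ?case
  proof (cases "e = 1")
    case False
    then obtain q f where q: "prime q" "e = q * f"
      using prime_factor_nat by (metis dvdE)
    have "f < e" "f > 0"
      using q less.prems(1) prime_gt_1_nat[OF q(1)] by auto
    then have "f dvd p ^ f"
      using less q by auto
    moreover have "q dvd p"
      using less.prems(2) q by auto
    ultimately have "e dvd p ^ Suc f"
      using q(2) by (simp add: mult_dvd_mono)
    also have "p ^ Suc f dvd p ^ e"
      using \<open>f < e\<close> by (intro le_imp_power_dvd) simp
    finally show ?thesis .
  qed simp
qed

lemma dvd_primorial_power:
  assumes "e > 0"
  obtains B where "\<And>X. X \<ge> B \<Longrightarrow> int e dvd primorial X ^ X"
proof -
  define D where "D = {q. prime q \<and> q dvd e}"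
  have "finite D"
    using assms by (auto simp: D_def intro: finite_subset[of _ "{..e}"] dvd_imp_le)
  have "\<exists>l. nth_prime l = int q" if "q \<in> D" for q
    using that nth_prime_surj[of "int q"] by (simp add: D_def)
  then obtain l where l: "\<And>q. q \<in> D \<Longrightarrow> nth_prime (l q) = int q"
    by metis
  define B where "B = Max (insert e ((\<lambda>q. Suc (l q)) ` D))"
  show ?thesis
  proof (rule that[of B])
    fix X assume "X \<ge> B"
    have le: "z \<le> X" if "z \<in> insert e ((\<lambda>q. Suc (l q)) ` D)" for z
      using \<open>X \<ge> B\<close> \<open>finite D\<close> that unfolding B_def by (meson Max_ge finite.insertI finite_imageI order_trans)
    have "q dvd nat (primorial X)" if "prime q" "q dvd e" for q
    proof -
      have "q \<in> D"
        using that by (simp add: D_def)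
      then have "int q dvd primorial X"
        using l[of q] le[of "Suc (l q)"] nth_prime_dvd_primorial[of "l q" X] by auto
      then show ?thesis
        using primorial_pos[of X] by (metis int_dvd_int_iff less_imp_le nat_0_le)
    qed
    then have "e dvd nat (primorial X) ^ e"
      using assms by (intro dvd_power_of_prime_divisors) auto
    then have "e dvd nat (primorial X) ^ X"
      using le[of e] by (auto intro: dvd_trans le_imp_power_dvd)
    then have "int e dvd int (nat (primorial X) ^ X)"
      by (simp only: int_dvd_int_iff)
    then show "int e dvd primorial X ^ X"
      using primorial_pos[of X] by simp
  qed
qed

text \<open>\<open>y\<close> is the commutator of \<open>t\<close> and \<open>x\<close>. Writing
  this as an equation of products spares the computation of inverses in coordinates.\<close>

lemma normal_contains_commutator:
  assumes "group G" "M \<lhd> G" "t \<in> M" "x \<in> carrier G" "y \<in> carrier G"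
    and "y \<otimes>\<^bsub>G\<^esub> (x \<otimes>\<^bsub>G\<^esub> t) = t \<otimes>\<^bsub>G\<^esub> x"
  shows "y \<in> M"
proof -
  interpret group G by fact
  interpret M: normal M G by fact
  have t: "t \<in> carrier G"
    using assms(3) M.subset by blast
  have "y = (t \<otimes>\<^bsub>G\<^esub> x) \<otimes>\<^bsub>G\<^esub> inv\<^bsub>G\<^esub> (x \<otimes>\<^bsub>G\<^esub> t)"
    using assms t by (metis inv_solve_right m_closed)
  also have "\<dots> = t \<otimes>\<^bsub>G\<^esub> (x \<otimes>\<^bsub>G\<^esub> inv\<^bsub>G\<^esub> t \<otimes>\<^bsub>G\<^esub> inv\<^bsub>G\<^esub> x)"
    using assms t by (simp add: inv_mult_group m_assoc)
  also have "\<dots> \<in> M"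
    using assms M.inv_op_closed2[of x "inv\<^bsub>G\<^esub> t"] by auto
  finally show ?thesis .
qed

lemma finite_index_power:
  assumes "group G" "M \<in> finite_index_normals G"
  obtains e :: nat where "e > 0" "\<And>x. x \<in> carrier G \<Longrightarrow> x [^]\<^bsub>G\<^esub> e \<in> M"
proof -
  interpret G: group G by fact
  have fin: "finite (carrier (G Mod M))" and "M \<lhd> G"
    using assms(2) by (auto simp: finite_index_normals_def)
  interpret M: normal M G by fact
  interpret Q: group "G Mod M"
    by (rule M.factorgroup_is_group)
  have "x [^]\<^bsub>G\<^esub> order (G Mod M) \<in> M" if x: "x \<in> carrier G" for x
  proof -
    have "M #>\<^bsub>G\<^esub> x \<in> carrier (G Mod M)"
      using x by (auto simp: carrier_FactGroup)
    then have "(M #>\<^bsub>G\<^esub> x) [^]\<^bsub>G Mod M\<^esub> order (G Mod M) = M"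
      using Q.pow_order_eq_1 by simp
    then have "M #>\<^bsub>G\<^esub> (x [^]\<^bsub>G\<^esub> order (G Mod M)) = M"
      using M.FactGroup_pow[OF x] by simp
    then show ?thesis
      using G.rcos_self[OF _ M.subgroup_axioms] x by (metis G.nat_pow_closed)
  qed
  moreover have "order (G Mod M) > 0"
    using fin Q.order_gt_0_iff_finite by simp
  ultimately show ?thesis
    using that by blast
qed

lemma hall_elem_pow:
  "hall_elem j n 0 0 0 [^]\<^bsub>hall_group j\<^esub> (k::nat) = hall_elem j (int k * n) 0 0 0"
  "hall_elem j 0 a 0 0 [^]\<^bsub>hall_group j\<^esub> k = hall_elem j 0 (of_nat k * a) 0 0"
  "hall_elem j 0 0 b 0 [^]\<^bsub>hall_group j\<^esub> k = hall_elem j 0 0 (of_nat k * b) 0"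
  "hall_elem j 0 0 0 r [^]\<^bsub>hall_group j\<^esub> k = hall_elem j 0 0 0 (of_nat k * r)"
  by (induction k) (simp_all add: one_hall_group hall_elem_mult algebra_simps)

text \<open>
  The elements of \<open>(d, t\<^sup>m - 1)\<close> give the central elements forced into every normal subgroup of
  exponent \<open>d\<close> containing \<open>t\<^sup>m\<close>. The condition says that these are recognised by finitely many
  coordinates.
\<close>

definition centre_detected :: "(nat \<Rightarrow> int) \<Rightarrow> bool" where
  "centre_detected j \<longleftrightarrow>
     (\<forall>d m. d > 0 \<longrightarrow> m > 0 \<longrightarrow>
        (\<exists>X. \<forall>r. (\<forall>l<X. twist j r l = 0) \<longrightarrow> (\<exists>r'\<in>cong_ideal d m. twist j r = twist j r')))"

text \<open>Together with the finite index of the levels, this says that they induce the full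
  profinite topology on the twisted group.\<close>

lemma level_cofinal:
  assumes "centre_detected j" "M \<in> finite_index_normals (hall_group j)"
  shows "\<exists>X. level X \<inter> hall_set j \<subseteq> M"
proof -
  interpret G: group "hall_group j" by (rule group_hall_group)
  have "M \<lhd> hall_group j"
    using assms(2) by (simp add: finite_index_normals_def)
  interpret M: normal M "hall_group j" by fact
  have closed: "hall_mult x y \<in> M" if "x \<in> M" "y \<in> M" for x y
    using M.m_closed[OF that] by simp
  obtain e :: nat where e: "e > 0" "\<And>x. x \<in> hall_set j \<Longrightarrow> x [^]\<^bsub>hall_group j\<^esub> e \<in> M"
    using finite_index_power[OF group_hall_group assms(2)] by (metis carrier_hall_group)
  have t: "hall_elem j n 0 0 0 \<in> M" if "int e dvd n" for n
    using that e(2)[of "hall_elem j (n div int e) 0 0 0"] by (simp add: hall_elem_pow)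
  have comm: "y \<in> M" if "x \<in> M" "z \<in> hall_set j" "y \<in> hall_set j" "hall_mult y (hall_mult z x) = hall_mult x z" for x y z
    using normal_contains_commutator[OF group_hall_group \<open>M \<lhd> hall_group j\<close>, of x z y] that by simp
  \<comment> \<open>The factor 2 makes the action on \<open>b\<close> a plain power of t without
    sign.\<close>
  define I where "I = cong_ideal (int e) (2 * int e)"
  have aM: "hall_elem j 0 a 0 0 \<in> M" if a: "a \<in> I" for a
  proof -
    obtain u v where a: "a = of_int (int e) * u + (tpow (2 * int e) - 1) * v"
      using a by (auto simp: I_def cong_ideal_def)
    have "hall_elem j 0 (of_int (int e) * u) 0 0 \<in> M"
      using e(2)[of "hall_elem j 0 u 0 0"] by (simp add: hall_elem_pow)
    moreover have "hall_elem j 0 ((tpow (2 * int e) - 1) * v) 0 0 \<in> M"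
      by (rule comm[of "hall_elem j (2 * int e) 0 0 0" "hall_elem j 0 v 0 0"])
        (simp_all add: t hall_elem_mult algebra_simps)
    ultimately show ?thesis
      using closed by (fastforce simp: a hall_elem_mult)
  qed
  have bM: "hall_elem j 0 0 b 0 \<in> M" if b: "b \<in> I" for b
  proof -
    obtain u v where b: "b = of_int (int e) * u + (tpow (2 * int e) - 1) * v"
      using b by (auto simp: I_def cong_ideal_def)
    have "hall_elem j 0 0 (of_int (int e) * u) 0 \<in> M"
      using e(2)[of "hall_elem j 0 0 u 0"] by (simp add: hall_elem_pow)
    \<comment> \<open>The exponent of t is negative in the commutator because t acts on
      \<open>b\<close> through 1/t.\<close>
    moreover have "hall_elem j 0 0 ((tpow (2 * int e) - 1) * v) 0 \<in> M"
      by (rule comm[of "hall_elem j (- (2 * int e)) 0 0 0" "hall_elem j 0 0 v 0"])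
        (simp_all add: t hall_elem_mult ipow_even algebra_simps)
    ultimately show ?thesis
      using closed by (fastforce simp: b hall_elem_mult)
  qed
  \<comment> \<open>The commutator of an element of \<open>M\<close> with a = \<open>r\<close> and
    the element with b = 1 carries exactly \<open>r\<close> in the c coordinate.\<close>
  have cM: "hall_elem j 0 0 0 r \<in> M" if r: "r \<in> I" for r
    by (rule comm[of "hall_elem j 0 r 0 0" "hall_elem j 0 0 1 0"])
      (simp_all add: aM r hall_elem_mult)
  obtain X0 where X0: "\<And>r. (\<forall>l<X0. twist j r l = 0) \<Longrightarrow> \<exists>r'\<in>I. twist j r = twist j r'"
    using assms(1) e(1) unfolding centre_detected_def I_def by (metis mult_pos_pos of_nat_0_less_iff zero_less_numeral)
  obtain B where B: "\<And>X. X \<ge> B \<Longrightarrow> int e dvd primorial X ^ X"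
    using dvd_primorial_power[OF e(1)] by blast
  \<comment> \<open>\<open>X0\<close> takes care of the c coordinate, \<open>B\<close> makes
    \<open>e\<close> divide the modulus for \<open>a\<close> and \<open>b\<close>, and
    \<open>e\<close> itself makes \<open>2 * e\<close> divide the period.\<close>
  define X where "X = Max {X0, B, e}"
  have X: "X0 \<le> X" "B \<le> X" "e \<le> X"
    by (simp_all add: X_def)
  have "int e dvd radius X"
    using e(1) X(3) by (intro dvd_radius) auto
  then have per: "2 * int e dvd level_period X"
    unfolding level_period_def by (intro mult_dvd_mono) auto
  have I: "cong_ideal (primorial X ^ X) (level_period X) \<subseteq> I"
    unfolding I_def by (intro cong_ideal_mono B X per)
  have "x \<in> M" if x: "x \<in> level X \<inter> hall_set j" for x
  proof -
    obtain n a b r where x': "x = hall_elem j n a b r"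
      using x by (auto elim: hall_elem_cases)
    have n: "level_period X dvd n" and a: "a \<in> cong_ideal (primorial X ^ X) (level_period X)"
      and b: "\<And>l. l < X \<Longrightarrow> b \<in> cong_ideal (nth_prime l ^ X) (level_period X)"
      and c: "\<And>l. l < X \<Longrightarrow> twist j r l = 0"
      using x by (auto simp: x' level_def hall_elem_def)
    have "hall_elem j 0 0 0 r \<in> M"
    proof -
      obtain r' where "r' \<in> I" "twist j r = twist j r'"
        using X0[of r] c X(1) by auto
      then show ?thesis
        using cM[of r'] by (simp add: hall_elem_def)
    qed
    moreover have "hall_elem j 0 0 b 0 \<in> M"
      using cong_ideal_prod_coprime[OF b] I by (intro bM) auto
    moreover have "hall_elem j 0 a 0 0 \<in> M"
      using a I by (intro aM) auto
    moreover have "hall_elem j n 0 0 0 \<in> M"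
      using per n by (intro t) (meson dvd_mult_left dvd_trans mult.commute dvd_triv_right)
    ultimately show ?thesis
      unfolding x' by (subst hall_elem_factor) (intro closed)
  qed
  then show ?thesis by blast
qed

section \<open>Finite generation of the twisted groups\<close>

lemma laurent_additive_span:
  assumes add: "\<And>r s. r \<in> A \<Longrightarrow> s \<in> A \<Longrightarrow> r + s \<in> A" and minus: "\<And>r. r \<in> A \<Longrightarrow> - r \<in> A"
    and "\<And>k. tpow k \<in> A"
  shows "r \<in> A"
proof (induction r rule: laurent_induct)
  case (single k z)
  have pos: "Poly_Mapping.single k (int n) \<in> A" for n
  proof (induction n)
    case 0
    then show ?case
      using add[OF assms(3)[of k] minus[OF assms(3)[of k]]] by simp
  next
    case (Suc n)
    then show ?case
      using add[OF assms(3)[of k] Suc] by (simp flip: Poly_Mapping.single_add)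
  qed
  show ?case
  proof (cases "z \<ge> 0")
    case True
    then show ?thesis
      using pos[of "nat z"] by simp
  next
    case False
    then show ?thesis
      using minus[OF pos[of "nat (- z)"]] by (simp flip: Poly_Mapping.single_uminus)
  qed
qed (rule add)

lemma finitely_generated_hall_group: "finitely_generated (hall_group j)"
proof -
  interpret G: group "hall_group j" by (rule group_hall_group)
  define S where "S = {hall_elem j 1 0 0 0, hall_elem j 0 1 0 0, hall_elem j 0 0 1 0}"
  define K where "K = generate (hall_group j) S"
  have S: "S \<subseteq> carrier (hall_group j)"
    by (simp add: S_def)
  have sub: "subgroup K (hall_group j)"
    unfolding K_def by (rule G.generate_is_subgroup[OF S])
  interpret K: subgroup K "hall_group j" by fact
  have closed: "hall_mult x y \<in> K" if "x \<in> K" "y \<in> K" for x y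
    using K.m_closed[OF that] by simp
  have inverse: "y \<in> K" if "x \<in> K" "x \<in> hall_set j" "y \<in> hall_set j" "hall_mult y x = \<one>\<^bsub>hall_group j\<^esub>" for x y
    using K.m_inv_closed[OF that(1)] G.inv_equality[of y x] that by simp
  have gens: "hall_elem j 1 0 0 0 \<in> K" "hall_elem j 0 1 0 0 \<in> K" "hall_elem j 0 0 1 0 \<in> K"
    unfolding K_def by (auto simp: S_def intro: generate.incl)
  have t_nat: "hall_elem j (int n) 0 0 0 \<in> K" for n
  proof (induction n)
    case 0
    then show ?case
      using K.one_closed by (simp add: one_hall_group)
  next
    case (Suc n)
    then show ?case
      using closed[OF gens(1) Suc] by (simp add: hall_elem_mult)
  qed
  have t: "hall_elem j n 0 0 0 \<in> K" for n
  proof (cases "n \<ge> 0")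
    case True
    then show ?thesis
      using t_nat[of "nat n"] by simp
  next
    case False
    then show ?thesis
      using t_nat[of "nat (- n)"] by - (rule inverse[of "hall_elem j (- n) 0 0 0"], simp_all add: hall_elem_mult one_hall_group)
  qed
  have a: "hall_elem j 0 a 0 0 \<in> K" for a
  proof -
    have "a \<in> {a. hall_elem j 0 a 0 0 \<in> K}"
    proof (rule laurent_additive_span)
      fix r s assume "r \<in> {a. hall_elem j 0 a 0 0 \<in> K}" "s \<in> {a. hall_elem j 0 a 0 0 \<in> K}"
      then show "r + s \<in> {a. hall_elem j 0 a 0 0 \<in> K}"
        using closed[of "hall_elem j 0 r 0 0" "hall_elem j 0 s 0 0"] by (simp add: hall_elem_mult)
    next
      fix r assume "r \<in> {a. hall_elem j 0 a 0 0 \<in> K}"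
      then show "- r \<in> {a. hall_elem j 0 a 0 0 \<in> K}"
        using inverse[of "hall_elem j 0 r 0 0" "hall_elem j 0 (- r) 0 0"] by (simp add: hall_elem_mult one_hall_group)
    next
      fix k
      show "tpow k \<in> {a. hall_elem j 0 a 0 0 \<in> K}"
        using closed[OF closed[OF t[of k] gens(2)] t[of "- k"]] by (simp add: hall_elem_mult)
    qed
    then show ?thesis by simp
  qed
  have b: "hall_elem j 0 0 b 0 \<in> K" for b
  proof -
    have minus: "- r \<in> {b. hall_elem j 0 0 b 0 \<in> K}" if "r \<in> {b. hall_elem j 0 0 b 0 \<in> K}" for r
      using that inverse[of "hall_elem j 0 0 r 0" "hall_elem j 0 0 (- r) 0"] by (simp add: hall_elem_mult one_hall_group)
    have "b \<in> {b. hall_elem j 0 0 b 0 \<in> K}"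
    proof (rule laurent_additive_span)
      fix r s assume "r \<in> {b. hall_elem j 0 0 b 0 \<in> K}" "s \<in> {b. hall_elem j 0 0 b 0 \<in> K}"
      then show "r + s \<in> {b. hall_elem j 0 0 b 0 \<in> K}"
        using closed[of "hall_elem j 0 0 r 0" "hall_elem j 0 0 s 0"] by (simp add: hall_elem_mult)
    next
      fix k
      \<comment> \<open>Conjugating b = 1 by a power of t yields t^k only up to sign, which
        \<open>minus\<close> then corrects.\<close>
      have "ipow (- k) \<in> {b. hall_elem j 0 0 b 0 \<in> K}"
        using closed[OF closed[OF t[of "- k"] gens(3)] t[of k]] by (simp add: hall_elem_mult)
      then show "tpow k \<in> {b. hall_elem j 0 0 b 0 \<in> K}"
        using minus[of "ipow (- k)"] by (cases "even k") (simp_all add: ipow_def alt_def flip: Poly_Mapping.single_uminus)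
    qed (rule minus)
    then show ?thesis by simp
  qed
  have c: "hall_elem j 0 0 0 r \<in> K" for r
  proof -
    \<comment> \<open>A commutator of a = \<open>r\<close> and b = 1, so the c coordinate needs no
      generator of its own.\<close>
    have "hall_mult (hall_mult (hall_elem j 0 r 0 0) (hall_elem j 0 0 1 0))
        (hall_mult (hall_elem j 0 (- r) 0 0) (hall_elem j 0 0 (- 1) 0)) \<in> K"
      by (intro closed a b)
    then show ?thesis
      by (simp add: hall_elem_mult)
  qed
  have "hall_set j \<subseteq> K"
  proof
    fix x assume "x \<in> hall_set j"
    then obtain n a' b' r where x: "x = hall_elem j n a' b' r"
      by (rule hall_elem_cases)
    show "x \<in> K"
      unfolding x by (subst hall_elem_factor) (intro closed a b c t)
  qed
  moreover have "K \<subseteq> hall_set j"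
    using K.subset by simp
  ultimately have "generate (hall_group j) S = carrier (hall_group j)"
    by (simp add: K_def)
  moreover have "finite S"
    by (simp add: S_def)
  ultimately show ?thesis
    using S unfolding finitely_generated_def by blast
qed

section \<open>Torsion and centre\<close>

text \<open>A product of n primes is at least 2^n, which exceeds the absolute value of
  \<open>z\<close> for the chosen n. So an integer is determined by its residues at the primes, and
  untwisted c coordinates behave like integers.\<close>

lemma eq_zero_of_all_primes_dvd:
  assumes "\<And>l. nth_prime l dvd z"
  shows "z = 0"
proof (rule ccontr)
  assume "z \<noteq> 0"
  define n where "n = Suc (nat \<bar>z\<bar>)"
  have "primorial n dvd z"
    using assms by (simp add: primorial_dvd_iff)
  then have "\<bar>primorial n\<bar> \<le> \<bar>z\<bar>"
    using \<open>z \<noteq> 0\<close> by (intro dvd_imp_le_int)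
  moreover have "(2::int) ^ n \<le> primorial n"
    unfolding primorial_def using prod_mono[of "{..<n}" "\<lambda>_. 2" nth_prime] nth_prime_ge_2 by simp
  moreover have "\<bar>z\<bar> < int n"
    by (simp add: n_def)
  ultimately show False
    using power_gt_nat[of 2 n] by linarith
qed

lemma pairing_cong_one_minus:
  assumes "level_period X dvd K" "l < X"
  shows "nth_prime l dvd pairing gap_seq (s * (tpow K - 1))"
proof -
  have "s * (tpow K - 1) \<in> cong_ideal (nth_prime l ^ X) (level_period X)"
    by (intro cong_ideal_mult tpow_minus_1_in_cong_ideal assms)
  then show ?thesis
    using pairing_level assms(2) by blast
qed

text \<open>Vanishing at the first \<open>X\<close> primes means that the value on \<open>r\<close>
  is a multiple of \<open>primorial X\<close>. Integer multiples of t^(2 * radius X) - 1 attain all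
  such multiples, and they lie in the ideal through its second generator, so \<open>X\<close>
  depends on \<open>m\<close> alone.\<close>

lemma centre_detected_untwisted: "centre_detected (\<lambda>_. 0)"
  unfolding centre_detected_def
proof (intro allI impI)
  fix d m :: int assume "d > 0" "m > 0"
  define X where "X = nat m"
  have "m dvd radius X"
    using \<open>m > 0\<close> by (intro dvd_radius) (simp_all add: X_def)
  then have m: "m dvd 2 * radius X"
    by simp
  show "\<exists>X. \<forall>r. (\<forall>l<X. twist (\<lambda>_. 0) r l = 0) \<longrightarrow> (\<exists>r'\<in>cong_ideal d m. twist (\<lambda>_. 0) r = twist (\<lambda>_. 0) r')"
  proof (intro exI[of _ X] allI impI)
    fix r assume r: "\<forall>l<X. twist (\<lambda>_. 0) r l = 0"
    then have "primorial X dvd pairing gap_seq r"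
      by (simp add: primorial_dvd_iff twist_def mod_eq_0_iff_dvd)
    then obtain z where z: "pairing gap_seq r = primorial X * z" by auto
    define r' where "r' = of_int z * (tpow (2 * radius X) - 1)"
    have "r' \<in> cong_ideal d m"
      unfolding r'_def by (intro cong_ideal_mult tpow_minus_1_in_cong_ideal m)
    moreover have "pairing gap_seq (tpow (2 * radius X) - 1) = primorial X"
      using pairing_single[of gap_seq 0 1] by (simp add: pairing_diff gap_seq_centre gap_seq_zero)
    then have "twist (\<lambda>_. 0) r = twist (\<lambda>_. 0) r'"
      by (simp add: r'_def twist_def pairing_of_int_mult z mult.commute)
    ultimately show "\<exists>r'\<in>cong_ideal d m. twist (\<lambda>_. 0) r = twist (\<lambda>_. 0) r'"
      by blast
  qed
qed

abbreviation centre :: "nat \<Rightarrow> int" where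
  "centre l \<equiv> 2 * radius l"

text \<open>The shift moves an exponent k different from 0 into the gap beside the peak once
  \<open>radius l\<close> exceeds its absolute value, and there the sequence vanishes modulo
  \<open>nth_prime l\<close>.\<close>

lemma twist_centre_finite_support:
  assumes "Poly_Mapping.lookup r 0 = 0"
  obtains B where "\<And>l. l \<ge> B \<Longrightarrow> twist centre r l = 0"
proof -
  define B where "B = (\<Sum>k\<in>Poly_Mapping.keys r. nat \<bar>k\<bar>)"
  have "twist centre r l = 0" if l: "l \<ge> B" for l
  proof -
    have "nth_prime l dvd gap_seq (2 * radius l + k)" if k: "k \<in> Poly_Mapping.keys r" for k
    proof (rule gap_seq_near_centre)
      show "k \<noteq> 0"
        using k assms by (auto simp: in_keys_iff)
      have "nat \<bar>k\<bar> \<le> B"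
        unfolding B_def using k by (intro member_le_sum) auto
      then show "\<bar>k\<bar> < radius l"
        using l radius_gt[of l] by linarith
    qed
    then have "[pairing (\<lambda>k. gap_seq (2 * radius l + k)) r = pairing (\<lambda>_. 0) r] (mod nth_prime l)"
      by (intro pairing_cong) (simp add: cong_0_iff)
    then show ?thesis
      by (simp add: twist_def pairing_shift pairing_def[of "\<lambda>_. 0"] cong_def)
  qed
  then show ?thesis using that by blast
qed

lemma twist_add: "twist j (r + s) l = (twist j r l + twist j s l) mod nth_prime l"
  by (simp add: twist_def distrib_left pairing_add mod_add_eq)

lemma twist_of_int_mult: "twist j (of_int z * r) l = (z * twist j r l) mod nth_prime l"
  by (simp add: twist_def pairing_of_int_mult mult.left_commute mod_mult_right_eq)

text \<open>\<open>X\<close> lies beyond all primes dividing \<open>d\<close>. Moving the constant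
  term of \<open>r\<close> to t^K leaves \<open>r1\<close>, whose twist lives on finitely many
  primes from \<open>X\<close> on. Their product \<open>z\<close> kills that twist and is coprime to
  \<open>d\<close>, so the twist of \<open>r1\<close> is also that of a multiple of
  \<open>d\<close>.\<close>

lemma centre_detected_twisted: "centre_detected centre"
  unfolding centre_detected_def
proof (intro allI impI)
  fix d m :: int assume dm: "d > 0" "m > 0"
  define D where "D = {l. nth_prime l dvd d}"
  have "inj_on nth_prime D"
    by (auto intro: inj_onI)
  moreover have "nth_prime ` D \<subseteq> {0..d}"
    using dm zdvd_imp_le prime_ge_0_int[OF prime_nth_prime] by (auto simp: D_def)
  ultimately have "finite D"
    by (meson finite_atLeastAtMost_int finite_imageD finite_subset)
  define X where "X = Suc (Max (insert 0 D))"
  have X: "\<not> nth_prime l dvd d" if "l \<ge> X" for l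
  proof
    assume "nth_prime l dvd d"
    then have "l \<le> Max (insert 0 D)"
      using \<open>finite D\<close> by (intro Max_ge) (auto simp: D_def)
    then show False
      using that by (simp add: X_def)
  qed
  show "\<exists>X. \<forall>r. (\<forall>l<X. twist centre r l = 0) \<longrightarrow> (\<exists>r'\<in>cong_ideal d m. twist centre r = twist centre r')"
  proof (intro exI[of _ X] allI impI)
    fix r assume r: "\<forall>l<X. twist centre r l = 0"
    \<comment> \<open>The factor \<open>m\<close> puts t^K - 1 into the ideal, and
      \<open>level_period X\<close> hides it from the first \<open>X\<close> primes.\<close>
    define K where "K = m * level_period X"
    have "K \<noteq> 0"
      using dm level_period_pos[of X] by (simp add: K_def)
    define r0 where "r0 = of_int (Poly_Mapping.lookup r 0) * (tpow K - 1)"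
    define r1 where "r1 = r + r0"
    have "Poly_Mapping.lookup r0 0 = - Poly_Mapping.lookup r 0"
    proof -
      have "r0 = Poly_Mapping.single K (Poly_Mapping.lookup r 0) - Poly_Mapping.single 0 (Poly_Mapping.lookup r 0)"
        by (simp add: r0_def right_diff_distrib single_eq_of_int_mult[of K "Poly_Mapping.lookup r 0"]
            single_eq_of_int_mult[of 0 "Poly_Mapping.lookup r 0"])
      then show ?thesis
        using \<open>K \<noteq> 0\<close> by (simp add: lookup_minus Poly_Mapping.lookup_single_not_eq)
    qed
    then have "Poly_Mapping.lookup r1 0 = 0"
      by (simp add: r1_def Poly_Mapping.lookup_add)
    then obtain B where B: "\<And>l. l \<ge> B \<Longrightarrow> twist centre r1 l = 0"
      by (rule twist_centre_finite_support) blast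
    have r0: "twist centre r0 l = 0" if "l < X" for l
    proof -
      have "nth_prime l dvd pairing gap_seq ((tpow (2 * radius l) * of_int (Poly_Mapping.lookup r 0)) * (tpow K - 1))"
        using that by (intro pairing_cong_one_minus) (simp_all add: K_def)
      then show ?thesis
        by (simp add: twist_def r0_def mult.assoc mod_eq_0_iff_dvd)
    qed
    define z where "z = (\<Prod>l\<in>{X..<B}. nth_prime l)"
    have "twist centre r1 l = 0" if "l < X" for l
      using r r0[OF that] that by (simp add: r1_def twist_add)
    then have zr1: "twist centre (of_int z * r1) l = 0" for l
    proof (cases "X \<le> l \<and> l < B")
      case True
      then have "nth_prime l dvd z"
        unfolding z_def by (intro dvd_prodI) auto
      then show ?thesis
        by (simp add: twist_of_int_mult mod_eq_0_iff_dvd)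
    next
      case False
      then have "twist centre r1 l = 0"
        using B \<open>\<And>l. l < X \<Longrightarrow> twist centre r1 l = 0\<close> by (meson not_le)
      then show ?thesis
        by (simp add: twist_of_int_mult)
    qed
    have "coprime z d"
      unfolding z_def using X by (intro prod_coprime_left) (simp add: prime_imp_coprime)
    then obtain x y where xy: "x * z + y * d = 1"
      by (metis bezout_int coprime_imp_gcd_eq_1)
    \<comment> \<open>\<open>of_int d * (of_int y * r1)\<close> differs from \<open>r1\<close> by x
      * z * r1, whose twist is 0; subtracting \<open>r0\<close> undoes the move of the constant
      term.\<close>
    define r' where "r' = of_int d * (of_int y * r1) - r0"
    have "r0 \<in> cong_ideal d m"
      unfolding r0_def by (intro cong_ideal_mult tpow_minus_1_in_cong_ideal) (simp add: K_def)
    then have "r' \<in> cong_ideal d m"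
      unfolding r'_def by (intro cong_ideal_diff cong_ideal_of_int) simp_all
    moreover have "twist centre r l = twist centre r' l" for l
    proof -
      have "r = of_int (x * z + y * d) * r1 - r0"
        by (simp add: xy r1_def)
      also have "\<dots> = r' + of_int x * (of_int z * r1)"
        by (simp add: r'_def algebra_simps)
      finally have "twist centre r l = (twist centre r' l + (x * twist centre (of_int z * r1) l) mod nth_prime l) mod nth_prime l"
        by (simp only: twist_add twist_of_int_mult)
      then show ?thesis
        unfolding zr1 by (simp add: twist_def)
    qed
    then have "twist centre r = twist centre r'" ..
    ultimately show "\<exists>r'\<in>cong_ideal d m. twist centre r = twist centre r'"
      by blast
  qed
qed

lemma twist_untwisted_zero_iff: "twist (\<lambda>_. 0) r = (\<lambda>_. 0) \<longleftrightarrow> pairing gap_seq r = 0"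
  using eq_zero_of_all_primes_dvd[of "pairing gap_seq r"]
  by (auto simp: twist_def fun_eq_iff mod_eq_0_iff_dvd)

lemma hall_elem_eq_one_iff:
  "hall_elem j n a b r = hall_elem j 0 0 0 0 \<longleftrightarrow> n = 0 \<and> a = 0 \<and> b = 0 \<and> twist j r = (\<lambda>_. 0)"
proof -
  have "b = 0" if "\<And>l. tpow (j l) * b = 0"
    using tpow_cancel(4)[of "j 0" b] that[of 0] by simp
  then show ?thesis
    by (auto simp: hall_elem_def fun_eq_iff)
qed

lemma torsion_free_hall_group: "torsion_free (hall_group (\<lambda>_. 0))"
  unfolding torsion_free_def
proof (intro ballI allI impI, elim conjE)
  let ?j = "\<lambda>_::nat. 0::int"
  fix x k assume "x \<in> carrier (hall_group ?j)" and k: "(k::nat) > 0" "x [^]\<^bsub>hall_group ?j\<^esub> k = \<one>\<^bsub>hall_group ?j\<^esub>"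
  then obtain n a b r where x: "x = hall_elem ?j n a b r"
    by (auto elim: hall_elem_cases)
  \<comment> \<open>Only the exponent of t is tracked in a power until it is known to be 0; the
    other coordinates have a simple form only then.\<close>
  have "\<exists>a' b' r'. x [^]\<^bsub>hall_group ?j\<^esub> i = hall_elem ?j (int i * n) a' b' r'" for i :: nat
  proof (induction i)
    case 0
    then show ?case
      by (auto simp: one_hall_group)
  next
    case (Suc i)
    then obtain a' b' r' where "x [^]\<^bsub>hall_group ?j\<^esub> i = hall_elem ?j (int i * n) a' b' r'"
      by blast
    moreover have "int (Suc i) * n = int i * n + n"
      by (simp add: algebra_simps)
    ultimately show ?case
      by (simp only: nat_pow_Suc mult_hall_group x hall_elem_mult) (intro exI, rule refl)
  qed
  then obtain a' b' r' where "hall_elem ?j (int k * n) a' b' r' = hall_elem ?j 0 0 0 0"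
    using k(2) one_hall_group[of ?j] by metis
  then have "n = 0"
    using k(1) by (simp add: hall_elem_eq_one_iff)
  have "\<exists>r'. x [^]\<^bsub>hall_group ?j\<^esub> i = hall_elem ?j 0 (of_nat i * a) (of_nat i * b) r'" for i :: nat
  proof (induction i)
    case 0
    then show ?case
      by (auto simp: one_hall_group)
  next
    case (Suc i)
    then show ?case
      by (auto simp: x \<open>n = 0\<close> hall_elem_mult algebra_simps)
  qed
  then obtain r' where "hall_elem ?j 0 (of_nat k * a) (of_nat k * b) r' = hall_elem ?j 0 0 0 0"
    using k(2) one_hall_group[of ?j] by metis
  then have "a = 0" "b = 0"
    using k(1) by (simp_all add: hall_elem_eq_one_iff)
  then have "twist ?j (of_nat k * r) = (\<lambda>_. 0)"
    using k by (simp add: x \<open>n = 0\<close> hall_elem_pow one_hall_group hall_elem_eq_one_iff)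
  then have "int k * pairing gap_seq r = 0"
    using pairing_of_int_mult[of gap_seq "int k" r] by (simp add: twist_untwisted_zero_iff)
  then have "twist ?j r = (\<lambda>_. 0)"
    using k(1) by (simp add: twist_untwisted_zero_iff)
  then show "x = \<one>\<^bsub>hall_group ?j\<^esub>"
    by (simp add: x \<open>n = 0\<close> \<open>a = 0\<close> \<open>b = 0\<close> one_hall_group hall_elem_eq_one_iff)
qed

lemma hall_elem_eqD:
  assumes "hall_elem j n a b r = hall_elem j n' a' b' r'"
  shows "n = n'" "a = a'" "b = b'" "twist j r = twist j r'"
proof -
  have "tpow (j 0) * b = tpow (j 0) * b'"
    using assms by (simp add: hall_elem_def fun_eq_iff)
  then show "b = b'"
    by (metis tpow_cancel(4))
qed (use assms in \<open>simp_all add: hall_elem_def\<close>)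

text \<open>Commuting with a = 1 forces n = 0, and commuting with t forces a = b = 0 and makes c
  equal to -c. Untwisted, c comes from an integer, so it vanishes.\<close>

lemma trivial_center_hall_group: "has_trivial_center (hall_group (\<lambda>_. 0))"
proof -
  let ?j = "\<lambda>_::nat. 0::int"
  interpret group "hall_group ?j" by (rule group_hall_group)
  have "z = \<one>\<^bsub>hall_group ?j\<^esub>" if z: "z \<in> group_center (hall_group ?j)" for z
  proof -
    obtain n a b r where z': "z = hall_elem ?j n a b r"
      using z by (auto simp: group_center_def elim: hall_elem_cases)
    have comm: "hall_mult z x = hall_mult x z" if "x \<in> hall_set ?j" for x
      using z that by (simp add: group_center_def)
    have "a + tpow n = 1 + a"
      using hall_elem_eqD(2)[OF comm[of "hall_elem ?j 0 1 0 0", unfolded z' hall_elem_mult]] by simp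
    then have "tpow n * 1 = (1 :: laurent)"
      by simp
    then have "n = 0"
      using tpow_fixed_imp_zero[of n 1] by auto
    note t = hall_elem_eqD[OF comm[of "hall_elem ?j 1 0 0 0", unfolded z' hall_elem_mult \<open>n = 0\<close>]]
    have "tpow 1 * a = a"
      using t(2) by simp
    then have "a = 0"
      using tpow_fixed_imp_zero[of 1 a] by simp
    have "ipow 1 * b = b"
      using t(3) by simp
    \<comment> \<open>Applying -1/t twice removes the sign, so that
      \<open>tpow_fixed_imp_zero\<close> applies.\<close>
    then have "ipow (1 + 1) * b = b"
      by (simp only: ipow_add mult.assoc)
    then have "tpow (- 2) * b = b"
      by (simp add: ipow_even)
    then have "b = 0"
      using tpow_fixed_imp_zero[of "- 2" b] by simp
    have "twist ?j r = twist ?j (- r)"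
      using t(4) by (simp add: alt_def \<open>a = 0\<close> \<open>b = 0\<close>)
    then have "nth_prime l dvd 2 * pairing gap_seq r" for l
      by (auto simp: twist_def fun_eq_iff pairing_minus mod_eq_dvd_iff)
    then have "2 * pairing gap_seq r = 0"
      by (rule eq_zero_of_all_primes_dvd)
    then show ?thesis
      by (simp add: z' \<open>n = 0\<close> \<open>a = 0\<close> \<open>b = 0\<close> one_hall_group hall_elem_eq_one_iff twist_untwisted_zero_iff)
  qed
  moreover have "\<one>\<^bsub>hall_group ?j\<^esub> \<in> group_center (hall_group ?j)"
    by (simp add: group_center_def del: mult_hall_group carrier_hall_group)
  ultimately show ?thesis
    unfolding has_trivial_center_def by blast
qed

text \<open>t^K has a finitely supported twist because K is not 0. At the prime 2 it takes the
  residue of the peak, which is odd, since K is a period there. Multiplying by the other primes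
  below the bound leaves only the coordinate at 2.\<close>

lemma twisted_central_involution:
  obtains r where "twist centre r \<noteq> (\<lambda>_. 0)" "\<And>l. nth_prime l dvd 2 * twist centre r l"
proof -
  obtain l0 where l0: "nth_prime l0 = 2"
    using nth_prime_surj[of 2] by auto
  define K where "K = level_period (Suc l0)"
  have "Poly_Mapping.lookup (tpow K) 0 = 0"
    using level_period_pos[of "Suc l0"] by (simp add: K_def Poly_Mapping.lookup_single_not_eq)
  then obtain B where B: "\<And>l. l \<ge> B \<Longrightarrow> twist centre (tpow K) l = 0"
    by (rule twist_centre_finite_support) blast
  define z where "z = (\<Prod>l\<in>{..<B} - {l0}. nth_prime l)"
  have "coprime z 2"
    unfolding z_def l0[symmetric] by (intro prod_coprime_left coprime_nth_prime) auto
  have "[gap_seq (2 * radius l0 + K) = gap_seq (2 * radius l0)] (mod nth_prime l0)"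
    by (rule gap_seq_periodic[of l0 "Suc l0"]) (simp_all add: K_def level_period_def)
  then have "[gap_seq (2 * radius l0 + K) = primorial l0] (mod 2)"
    by (simp add: gap_seq_centre l0)
  moreover have "odd (primorial l0)"
    using coprime_primorial[of l0] l0 by (simp add: coprime_right_2_iff_odd)
  ultimately have "odd (gap_seq (2 * radius l0 + K))"
    using cong_dvd_iff by blast
  then have "odd (z * gap_seq (2 * radius l0 + K))"
    using \<open>coprime z 2\<close> by (simp add: coprime_right_2_iff_odd)
  then have "twist centre (of_int z * tpow K) l0 \<noteq> 0"
    using l0 by (simp add: twist_of_int_mult) (simp add: twist_def Poly_Mapping.mult_single mod_mult_right_eq odd_iff_mod_2_eq_one)
  moreover have "nth_prime l dvd 2 * twist centre (of_int z * tpow K) l" for l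
  proof (cases "l = l0")
    case False
    have "nth_prime l dvd z * twist centre (tpow K) l"
    proof (cases "l < B")
      case True
      then have "nth_prime l dvd z"
        using False unfolding z_def by (intro dvd_prodI) auto
      then show ?thesis by simp
    qed (simp add: B)
    then show ?thesis
      by (simp add: twist_of_int_mult mod_eq_0_iff_dvd[THEN iffD2])
  qed (simp add: l0)
  ultimately show ?thesis
    using that by (metis)
qed

lemma hall_group_twisted_involution:
  obtains x where "x \<in> carrier (hall_group centre)" "x \<noteq> \<one>\<^bsub>hall_group centre\<^esub>"
    "x [^]\<^bsub>hall_group centre\<^esub> (2::nat) = \<one>\<^bsub>hall_group centre\<^esub>" "x \<in> group_center (hall_group centre)"
proof -
  obtain r where r: "twist centre r \<noteq> (\<lambda>_. 0)" "\<And>l. nth_prime l dvd 2 * twist centre r l"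
    using twisted_central_involution by blast
  define x where "x = hall_elem centre 0 0 0 r"
  have "twist centre (of_nat 2 * r) = (\<lambda>_. 0)"
    using r(2) twist_of_int_mult[of centre 2 r] by (auto simp: mod_eq_0_iff_dvd)
  then have pow: "x [^]\<^bsub>hall_group centre\<^esub> (2::nat) = \<one>\<^bsub>hall_group centre\<^esub>"
    by (simp only: x_def hall_elem_pow one_hall_group hall_elem_eq_one_iff)
  \<comment> \<open>\<open>r\<close> and \<open>- r\<close> have the same twist, so the sign with
    which t acts on c does not affect \<open>x\<close>.\<close>
  have neg: "twist centre (s + of_int (alt n) * r) = twist centre (r + s)" for s n
  proof (cases "even n")
    case False
    have "nth_prime l dvd 2 * pairing gap_seq (tpow (centre l) * r)" for l
      using r(2)[of l] by (simp add: twist_def dvd_eq_mod_eq_0 mod_mult_right_eq)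
    then show ?thesis
      using False
      by (auto simp: fun_eq_iff alt_def twist_def mod_eq_dvd_iff pairing_add pairing_minus pairing_diff algebra_simps)
  qed (simp add: alt_def add.commute)
  have "x \<in> group_center (hall_group centre)"
  proof -
    have "hall_mult x y = hall_mult y x" if y_in: "y \<in> hall_set centre" for y
    proof -
      obtain n a b s where y: "y = hall_elem centre n a b s"
        using y_in by (rule hall_elem_cases)
      show ?thesis
        unfolding x_def y hall_elem_mult using neg[of s n] by (simp add: hall_elem_def)
    qed
    then show ?thesis
      by (simp add: group_center_def x_def)
  qed
  then show ?thesis
    using that[of x] pow r(1) by (simp add: x_def one_hall_group hall_elem_eq_one_iff)
qed

section \<open>Countable models\<close>

lemma countable_generate:
  assumes "countable S" shows "countable (generate G S)"
proof -
  define step where "step A = A \<union> (\<lambda>(x, y). x \<otimes>\<^bsub>G\<^esub> y) ` (A \<times> A)" for A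
  define T where "T n = (step ^^ n) (insert \<one>\<^bsub>G\<^esub> (S \<union> (\<lambda>x. inv\<^bsub>G\<^esub> x) ` S))" for n
  have "countable (T n)" for n
    by (induction n) (use assms in \<open>auto simp: T_def step_def\<close>)
  moreover have mono: "T m \<subseteq> T n" if "m \<le> n" for m n
    using that by (induction n rule: dec_induct) (auto simp: T_def step_def)
  have "generate G S \<subseteq> (\<Union>n. T n)"
  proof
    fix x assume "x \<in> generate G S"
    then show "x \<in> (\<Union>n. T n)"
    proof (induction rule: generate.induct)
      case one
      show ?case by (intro UN_I[of 0]) (auto simp: T_def)
    next
      case (incl h)
      then show ?case by (intro UN_I[of 0]) (auto simp: T_def)
    next
      case (inv h)
      then show ?case by (intro UN_I[of 0]) (auto simp: T_def)
    next
      case (eng x y)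
      then obtain m n where "x \<in> T m" "y \<in> T n" by blast
      then have "x \<in> T (max m n)" "y \<in> T (max m n)"
        using mono[of m "max m n"] mono[of n "max m n"] by auto
      then have "x \<otimes>\<^bsub>G\<^esub> y \<in> T (Suc (max m n))"
        by (auto simp: T_def step_def)
      then show ?case by blast
    qed
  qed
  ultimately show ?thesis
    by (meson countable_UN countable_subset countableI_type)
qed

lemma countable_group_nat_copy:
  assumes "group G" "countable (carrier G)"
  obtains \<Gamma> :: "nat monoid" and h where "group \<Gamma>" "h \<in> iso \<Gamma> G"
proof -
  interpret G: group G by fact
  define f where "f = to_nat_on (carrier G)"
  define k where "k = from_nat_into (carrier G)"
  have kf: "k (f x) = x" if "x \<in> carrier G" for x
    using that assms(2) by (simp add: k_def f_def)
  define \<Gamma> :: "nat monoid" where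
    "\<Gamma> = \<lparr>carrier = f ` carrier G, monoid.mult = (\<lambda>x y. f (k x \<otimes>\<^bsub>G\<^esub> k y)), one = f \<one>\<^bsub>G\<^esub>\<rparr>"
  have "group \<Gamma>"
  proof (rule groupI)
    fix x assume "x \<in> carrier \<Gamma>"
    then obtain y where y: "y \<in> carrier G" "x = f y"
      by (auto simp: \<Gamma>_def)
    then show "\<exists>z\<in>carrier \<Gamma>. z \<otimes>\<^bsub>\<Gamma>\<^esub> x = \<one>\<^bsub>\<Gamma>\<^esub>"
      by (intro bexI[of _ "f (inv\<^bsub>G\<^esub> y)"]) (auto simp: \<Gamma>_def kf)
  qed (auto simp: \<Gamma>_def kf G.m_assoc)
  moreover have "k \<in> iso \<Gamma> G"
    unfolding iso_def hom_def by (auto simp: \<Gamma>_def kf intro!: bij_betw_byWitness[of _ f])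
  ultimately show ?thesis
    by (rule that)
qed

lemma finitely_generated_iso:
  assumes "group G" "group H" "h \<in> iso G H" "finitely_generated G"
  shows "finitely_generated H"
proof -
  interpret group_hom G H h
    using assms by (simp add: group_hom_def group_hom_axioms_def iso_def)
  obtain S where S: "finite S" "S \<subseteq> carrier G" "generate G S = carrier G"
    using assms(4) by (auto simp: finitely_generated_def)
  have "generate H (h ` S) = h ` carrier G"
    using generate_img[OF S(2)] S(3) by simp
  also have "\<dots> = carrier H"
    using assms(3) by (simp add: iso_def bij_betw_def)
  finally show ?thesis
    unfolding finitely_generated_def using S by (intro exI[of _ "h ` S"]) auto
qed

lemma torsion_free_iso:
  assumes "group G" "group H" "h \<in> iso G H" "torsion_free H"
  shows "torsion_free G"
  unfolding torsion_free_def
proof (intro ballI allI impI, elim conjE)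
  interpret group_hom G H h
    using assms by (simp add: group_hom_def group_hom_axioms_def iso_def)
  fix x n assume x: "x \<in> carrier G" "(n::nat) > 0" "x [^]\<^bsub>G\<^esub> n = \<one>\<^bsub>G\<^esub>"
  then have "h x [^]\<^bsub>H\<^esub> n = \<one>\<^bsub>H\<^esub>"
    using hom_nat_pow[of x n] by simp
  then have "h x = h \<one>\<^bsub>G\<^esub>"
    using assms(4) x by (auto simp: torsion_free_def)
  then show "x = \<one>\<^bsub>G\<^esub>"
    using assms(3) x(1) G.one_closed unfolding iso_def bij_betw_def inj_on_def by blast
qed

lemma has_trivial_center_iso:
  assumes "group G" "group H" "h \<in> iso G H" "has_trivial_center H"
  shows "has_trivial_center G"
proof -
  interpret group_hom G H h
    using assms by (simp add: group_hom_def group_hom_axioms_def iso_def)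
  have bij: "bij_betw h (carrier G) (carrier H)"
    using assms(3) by (simp add: iso_def)
  have "z = \<one>\<^bsub>G\<^esub>" if z: "z \<in> group_center G" for z
  proof -
    have zG: "z \<in> carrier G"
      using z by (simp add: group_center_def)
    have "h z \<otimes>\<^bsub>H\<^esub> y = y \<otimes>\<^bsub>H\<^esub> h z" if y: "y \<in> carrier H" for y
    proof -
      obtain x where "x \<in> carrier G" "y = h x"
        using bij y unfolding bij_betw_def by blast
      then show ?thesis
        using z zG by (simp add: group_center_def flip: hom_mult)
    qed
    then have "h z \<in> group_center H"
      using zG by (simp add: group_center_def)
    then have "h z = h \<one>\<^bsub>G\<^esub>"
      using assms(4) by (simp add: has_trivial_center_def)
    then show ?thesis
      using bij zG G.one_closed unfolding bij_betw_def inj_on_def by blast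
  qed
  then show ?thesis
    by (auto simp: has_trivial_center_def group_center_def)
qed

text \<open>The cosets of the preimage inject into the cosets of \<open>N\<close>, through the map
  induced by \<open>h\<close>.\<close>

lemma preimage_finite_index:
  assumes "group G" "group H" "h \<in> hom H G" "N \<in> finite_index_normals G"
  shows "h -` N \<inter> carrier H \<in> finite_index_normals H"
proof -
  interpret group_hom H G h
    using assms by (simp add: group_hom_def group_hom_axioms_def)
  have N: "N \<lhd> G" and fin: "finite (rcosets\<^bsub>G\<^esub> N)"
    using assms(4) by (auto simp: finite_index_normals_def FactGroup_def)
  interpret N: normal N G by fact
  let ?P = "h -` N \<inter> carrier H"
  have P: "?P \<lhd> H"
    using normal_vimage assms N by blast
  have "inj_on (\<lambda>C. N <#>\<^bsub>G\<^esub> h ` C) (rcosets\<^bsub>H\<^esub> ?P)"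
  proof (rule inj_onI)
    fix C C' assume "C \<in> rcosets\<^bsub>H\<^esub> ?P" "C' \<in> rcosets\<^bsub>H\<^esub> ?P" and eq: "N <#>\<^bsub>G\<^esub> h ` C = N <#>\<^bsub>G\<^esub> h ` C'"
    then obtain p p' where p: "p \<in> carrier H" "p' \<in> carrier H" "C = ?P #>\<^bsub>H\<^esub> p" "C' = ?P #>\<^bsub>H\<^esub> p'"
      by (auto simp: RCOSETS_def)
    have "N #>\<^bsub>G\<^esub> h p = N #>\<^bsub>G\<^esub> h p'"
      using eq group_coset_hom_image[OF assms(1-3) N] p by simp
    then have "h p' \<otimes>\<^bsub>G\<^esub> inv\<^bsub>G\<^esub> h p \<in> N"
      using rcos_eq_iff[OF assms(1) N.subgroup_axioms] p by simp
    then have "p' \<otimes>\<^bsub>H\<^esub> inv\<^bsub>H\<^esub> p \<in> ?P"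
      using p by simp
    then show "C = C'"
      using rcos_eq_iff[OF assms(2) normal_imp_subgroup[OF P]] p by simp
  qed
  moreover have "(\<lambda>C. N <#>\<^bsub>G\<^esub> h ` C) ` (rcosets\<^bsub>H\<^esub> ?P) \<subseteq> rcosets\<^bsub>G\<^esub> N"
    using group_coset_hom_image[OF assms(1-3) N] by (fastforce simp: RCOSETS_def)
  ultimately have "finite (rcosets\<^bsub>H\<^esub> ?P)"
    using fin inj_on_finite by blast
  then show ?thesis
    using P by (simp add: finite_index_normals_def FactGroup_def)
qed

lemma level_finite_index_normal: "level X \<in> finite_index_normals ambient"
  by (simp add: finite_index_normals_def level_normal level_finite_index)

text \<open>The copy on \<open>nat\<close> is compared with the ambient group directly, through
  \<open>h\<close> followed by the inclusion of the twisted group.\<close>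

lemma hall_group_nat_model:
  assumes "centre_detected j"
  obtains \<Gamma> :: "nat monoid" and h where
    "group \<Gamma>" "h \<in> iso \<Gamma> (hall_group j)" "finitely_generated \<Gamma>" "residually_finite \<Gamma>"
    "limits_isomorphic \<Gamma> (finite_index_normals \<Gamma>) ambient (range level)"
proof -
  interpret K: group "hall_group j" by (rule group_hall_group)
  have "countable (carrier (hall_group j))"
    using finitely_generated_hall_group[of j] countable_generate countable_finite
    unfolding finitely_generated_def by metis
  then obtain \<Gamma> :: "nat monoid" and h where \<Gamma>: "group \<Gamma>" "h \<in> iso \<Gamma> (hall_group j)"
    using countable_group_nat_copy[OF group_hall_group] by blast
  interpret \<Gamma>: group \<Gamma> by fact
  have bij: "bij_betw h (carrier \<Gamma>) (hall_set j)"
    using \<Gamma>(2) by (simp add: iso_def)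
  have hom: "h \<in> hom \<Gamma> ambient"
    using \<Gamma>(2) hall_set_ambient[of j] by (auto simp: iso_def hom_def)
  interpret h: group_hom \<Gamma> ambient h
    using hom group_ambient \<Gamma>(1) by (simp add: group_hom_def group_hom_axioms_def)
  have fg: "finitely_generated \<Gamma>"
    using finitely_generated_iso[OF group_hall_group \<Gamma>(1) group.iso_set_sym[OF \<Gamma>] finitely_generated_hall_group] .
  have pre: "h -` level X \<inter> carrier \<Gamma> \<in> finite_index_normals \<Gamma>" for X
    using preimage_finite_index[OF group_ambient \<Gamma>(1) hom level_finite_index_normal] .
  have rf: "residually_finite \<Gamma>"
    unfolding residually_finite_def
  proof (intro ballI impI)
    fix g assume g: "g \<in> carrier \<Gamma>" "g \<noteq> \<one>\<^bsub>\<Gamma>\<^esub>"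
    have "h g \<noteq> h \<one>\<^bsub>\<Gamma>\<^esub>"
      using g bij \<Gamma>.one_closed unfolding bij_betw_def inj_on_def by blast
    then have "h g \<noteq> \<one>\<^bsub>ambient\<^esub>"
      using h.hom_one by metis
    moreover have "h g \<in> hall_set j"
      using bij g by (auto simp: bij_betw_def)
    ultimately obtain X where "h g \<notin> level X"
      using level_separates by blast
    then show "\<exists>N\<in>finite_index_normals \<Gamma>. g \<notin> N"
      by (intro bexI[OF _ pre[of X]]) simp
  qed
  have "limits_isomorphic \<Gamma> (finite_index_normals \<Gamma>) ambient (range level)"
  proof (rule limits_isomorphic_dense_hom[OF \<Gamma>(1) group_ambient hom])
    fix M assume M: "M \<in> finite_index_normals \<Gamma>"
    then show "M \<lhd> \<Gamma>"
      by (simp add: finite_index_normals_def)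
    \<comment> \<open>Cofinality is known in \<open>hall_group j\<close>, so \<open>M\<close> is
      carried there along the inverse of \<open>h\<close>.\<close>
    define k where "k = inv_into (carrier \<Gamma>) h"
    have "k \<in> iso (hall_group j) \<Gamma>"
      unfolding k_def by (rule group.iso_set_sym[OF \<Gamma>])
    then have "k \<in> hom (hall_group j) \<Gamma>"
      by (simp add: iso_def)
    then have "k -` M \<inter> carrier (hall_group j) \<in> finite_index_normals (hall_group j)"
      using preimage_finite_index[OF \<Gamma>(1) group_hall_group _ M] by blast
    then obtain X where X: "level X \<inter> hall_set j \<subseteq> k -` M \<inter> hall_set j"
      using level_cofinal[OF assms] by (metis carrier_hall_group)
    have "h -` level X \<inter> carrier \<Gamma> \<subseteq> M"
    proof
      fix g assume g: "g \<in> h -` level X \<inter> carrier \<Gamma>"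
      then have "h g \<in> level X \<inter> hall_set j"
        using bij by (auto simp: bij_betw_def)
      then have "k (h g) \<in> M"
        using X by blast
      then show "g \<in> M"
        using g bij by (simp add: k_def bij_betw_def)
    qed
    then show "\<exists>N\<in>range level. h -` N \<inter> carrier \<Gamma> \<subseteq> M"
      by blast
  next
    fix N g assume "N \<in> range level" and g: "g \<in> carrier ambient"
    then obtain X where N: "N = level X" by blast
    obtain x where x: "x \<in> hall_set j" "g \<in> level X #>\<^bsub>ambient\<^esub> x"
      using hall_set_dense[OF g] by blast
    then obtain p where "p \<in> carrier \<Gamma>" "x = h p"
      using bij by (auto simp: bij_betw_def)
    then show "\<exists>p\<in>carrier \<Gamma>. g \<in> N #>\<^bsub>ambient\<^esub> h p"
      using x N by blast
  next
    fix N N' assume "N \<in> range level" "N' \<in> range level"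
    then obtain X X' where "N = level X" "N' = level X'" by blast
    then have "level (max X X') \<subseteq> N \<inter> N'"
      using level_antimono[of X "max X X'"] level_antimono[of X' "max X X'"] by auto
    then show "\<exists>N''\<in>range level. N'' \<subseteq> N \<inter> N'"
      by blast
  qed (use pre level_normal in auto)
  then show ?thesis
    using that \<Gamma> fg rf by blast
qed

theorem proposition1p5:
  shows
    "(\<not> profinite_property (torsion_free :: nat monoid \<Rightarrow> bool) \<and>
      (\<exists>(\<Gamma>\<^sub>1 :: nat monoid) (\<Gamma>\<^sub>2 :: nat monoid).
         group \<Gamma>\<^sub>1 \<and> finitely_generated \<Gamma>\<^sub>1 \<and> residually_finite \<Gamma>\<^sub>1 \<and>
         group \<Gamma>\<^sub>2 \<and> finitely_generated \<Gamma>\<^sub>2 \<and> residually_finite \<Gamma>\<^sub>2 \<and>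
         isomorphic_profinite_completions \<Gamma>\<^sub>1 \<Gamma>\<^sub>2 \<and>
         torsion_free \<Gamma>\<^sub>1 \<and> \<not> torsion_free \<Gamma>\<^sub>2)) \<and>
     (\<not> profinite_property (has_trivial_center :: nat monoid \<Rightarrow> bool) \<and>
      (\<exists>(\<Gamma>\<^sub>1 :: nat monoid) (\<Gamma>\<^sub>2 :: nat monoid).
         group \<Gamma>\<^sub>1 \<and> finitely_generated \<Gamma>\<^sub>1 \<and> residually_finite \<Gamma>\<^sub>1 \<and>
         group \<Gamma>\<^sub>2 \<and> finitely_generated \<Gamma>\<^sub>2 \<and> residually_finite \<Gamma>\<^sub>2 \<and>
         isomorphic_profinite_completions \<Gamma>\<^sub>1 \<Gamma>\<^sub>2 \<and>
         has_trivial_center \<Gamma>\<^sub>1 \<and> \<not> has_trivial_center \<Gamma>\<^sub>2))"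
proof -
  obtain \<Gamma>\<^sub>1 :: "nat monoid" and h\<^sub>1 where \<Gamma>\<^sub>1: "group \<Gamma>\<^sub>1" "h\<^sub>1 \<in> iso \<Gamma>\<^sub>1 (hall_group (\<lambda>_. 0))"
      "finitely_generated \<Gamma>\<^sub>1" "residually_finite \<Gamma>\<^sub>1"
      "limits_isomorphic \<Gamma>\<^sub>1 (finite_index_normals \<Gamma>\<^sub>1) ambient (range level)"
    by (rule hall_group_nat_model[OF centre_detected_untwisted])
  obtain \<Gamma>\<^sub>2 :: "nat monoid" and h\<^sub>2 where \<Gamma>\<^sub>2: "group \<Gamma>\<^sub>2" "h\<^sub>2 \<in> iso \<Gamma>\<^sub>2 (hall_group centre)"
      "finitely_generated \<Gamma>\<^sub>2" "residually_finite \<Gamma>\<^sub>2"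
      "limits_isomorphic \<Gamma>\<^sub>2 (finite_index_normals \<Gamma>\<^sub>2) ambient (range level)"
    by (rule hall_group_nat_model[OF centre_detected_twisted])
  have iso: "isomorphic_profinite_completions \<Gamma>\<^sub>1 \<Gamma>\<^sub>2"
    using isomorphic_profinite_completions_common_limit \<Gamma>\<^sub>1(5) \<Gamma>\<^sub>2(1,5) by blast
  \<comment> \<open>One element serves both parts: it is an involution and it is central.\<close>
  obtain x where x: "x \<in> carrier (hall_group centre)" "x \<noteq> \<one>\<^bsub>hall_group centre\<^esub>"
    "x [^]\<^bsub>hall_group centre\<^esub> (2::nat) = \<one>\<^bsub>hall_group centre\<^esub>" "x \<in> group_center (hall_group centre)"
    by (rule hall_group_twisted_involution)
  have "\<not> torsion_free (hall_group centre)"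
    using x(1-3) unfolding torsion_free_def by (metis pos2)
  then have "torsion_free \<Gamma>\<^sub>1" "\<not> torsion_free \<Gamma>\<^sub>2"
    using torsion_free_iso[OF \<Gamma>\<^sub>1(1) group_hall_group \<Gamma>\<^sub>1(2) torsion_free_hall_group]
      torsion_free_iso[OF group_hall_group \<Gamma>\<^sub>2(1) group.iso_set_sym[OF \<Gamma>\<^sub>2(1,2)]] by blast+
  moreover have "\<not> has_trivial_center (hall_group centre)"
    using x(2,4) by (auto simp: has_trivial_center_def)
  then have "has_trivial_center \<Gamma>\<^sub>1" "\<not> has_trivial_center \<Gamma>\<^sub>2"
    using has_trivial_center_iso[OF \<Gamma>\<^sub>1(1) group_hall_group \<Gamma>\<^sub>1(2) trivial_center_hall_group]
      has_trivial_center_iso[OF group_hall_group \<Gamma>\<^sub>2(1) group.iso_set_sym[OF \<Gamma>\<^sub>2(1,2)]] by blast+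
  ultimately show ?thesis
    unfolding profinite_property_def using \<Gamma>\<^sub>1(1,3,4) \<Gamma>\<^sub>2(1,3,4) iso by blast
qed

end
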